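(* The four $k$-algebras $O_q(N^+)$, $O_q(N^+)'$, $O_q(N^-)$ and $O_q(N^-)'$ are all isomorphic as $k$-algebras.
   Context: $k$ is a field, $q\in k^\times$ is not a root of unity, $\widehat q=q-q^{-1}$, and $n\ge 1$. $O_q(\mathrm{SL}_{n+1})$ is the $k$-algebra generated by $X_{ij}$ ($1\le i,j\le n+1$) with relations (1) $X_{ij}X_{im}=qX_{im}X_{ij}$ for $j<m$; (2) $X_{ij}X_{lj}=qX_{lj}X_{ij}$ for $i<l$; (3) $X_{ij}X_{lm}=X_{lm}X_{ij}$ for $i<l$, $j>m$; (4) $X_{ij}X_{lm}-X_{lm}X_{ij}=\widehat q X_{im}X_{lj}$ for $i<l$, $j<m$; (5) $\sum_{\sigma\in \mathrm{Sym}_{n+1}}(-q)^{\ell(\sigma)}X_{1\sigma(1)}\cdots X_{n+1,\sigma(n+1)}=1$, where $\ell$ is the length function. $O_q(B^+)=O_q(\mathrm{SL}_{n+1})/\langle X_{ij}\mid i>j\rangle$ and $O_q(B^-)=O_q(\mathrm{SL}_{n+1})/\langle X_{ij}\mid i<j\rangle$ (quotients by two-sided ideals). Cosets of $X_{ij}$ are again denoted $X_{ij}$. In $O_q(B^\pm)$ the elements $X_{ii}$ commute with each other and $X_{11}\cdots X_{n+1,n+1}=1$, so each $X_{ii}$ is invertible. $O_q(N^+)$ and $O_q(N^+)'$ are the $k$-subalgebras of $O_q(B^+)$ generated respectively by $\{X_{ii}^{-1}X_{ij}\mid 1\le i<j\le n+1\}$ and by $\{X_{ij}X_{jj}^{-1}\mid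 1\le i<j\le n+1\}$. $O_q(N^-)$ and $O_q(N^-)'$ are the $k$-subalgebras of $O_q(B^-)$ generated respectively by $\{X_{jj}^{-1}X_{ji}\mid 1\le i<j\le n+1\}$ and by $\{X_{ji}X_{ii}^{-1}\mid 1\le i<j\le n+1\}$. *)

theory Defs
  imports
    "HOL-Library.Poly_Mapping"
    "HOL-Algebra.QuotRing"
    "HOL-Algebra.Subrings"
    "HOL-Algebra.Module"
    "HOL-Combinatorics.Permutations"
begin

section \<open>Unital associative algebras over a field\<close>

text \<open>
  The record type \<^typ>\<open>('k, 'a) module\<close> of HOL-Algebra carries a ring structure together with a
  scalar multiplication; it is used here for noncommutative unital algebras over a field
  given as a type \<open>'k\<close> of class \<^class>\<open>field\<close>. (The locale \<^locale>\<open>algebra\<close> of HOL-Algebra covers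
  only commutative algebras.)
\<close>

definition algebra_hom :: "('k, 'a) module \<Rightarrow> ('k, 'b) module \<Rightarrow> ('a \<Rightarrow> 'b) set" where
  "algebra_hom A B =
    {h \<in> ring_hom A B. \<forall>c. \<forall>x\<in>carrier A. h (c \<odot>\<^bsub>A\<^esub> x) = c \<odot>\<^bsub>B\<^esub> h x}"

definition algebra_isomorphic :: "('k, 'a) module \<Rightarrow> ('k, 'b) module \<Rightarrow> bool" where
  "algebra_isomorphic A B \<longleftrightarrow>
    (\<exists>h\<in>algebra_hom A B. bij_betw h (carrier A) (carrier B))"

definition is_unital_subalgebra :: "'a set \<Rightarrow> ('k, 'a) module \<Rightarrow> bool" where
  "is_unital_subalgebra S A \<longleftrightarrow>
    subring S A \<and> (\<forall>c. \<forall>x\<in>S. c \<odot>\<^bsub>A\<^esub> x \<in> S)"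

definition generated_subalgebra :: "('k, 'a) module \<Rightarrow> 'a set \<Rightarrow> ('k, 'a) module" where
  "generated_subalgebra A G =
    A \<lparr>carrier := \<Inter> {S. is_unital_subalgebra S A \<and> G \<subseteq> S}\<rparr>"

text \<open>
  The scalar multiplication on cosets follows the pattern of \<^const>\<open>rcoset_mult\<close>; see
  \<open>smult_quotient_algebra\<close> below.
\<close>

definition quotient_algebra :: "('k, 'a) module \<Rightarrow> 'a set \<Rightarrow> ('k, 'a set) module" where
  "quotient_algebra A I =
    ring.extend (A Quot I)
      (module.fields (\<lambda>c U. \<Union>u\<in>U. I +>\<^bsub>A\<^esub> (c \<odot>\<^bsub>A\<^esub> u)))"

lemma ring_quotient_algebra:
  assumes "ideal I A"
  shows "ring (quotient_algebra A I)"
proof -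
  interpret Q: ring "A Quot I"
    by (rule ideal.quotient_is_ring[OF assms])
  let ?Q = "quotient_algebra A I"
  have eqs: "carrier ?Q = carrier (A Quot I)" "monoid.mult ?Q = monoid.mult (A Quot I)"
    "one ?Q = one (A Quot I)" "zero ?Q = zero (A Quot I)" "add ?Q = add (A Quot I)"
    by (simp_all add: quotient_algebra_def ring.defs)
  show ?thesis
  proof (rule ringI)
    show "abelian_group ?Q"
      by (rule abelian_groupI)
        (auto simp: eqs Q.a_ac intro: Q.l_neg Q.a_inv_closed)
    show "Group.monoid ?Q"
      by (rule monoidI) (auto simp: eqs Q.m_assoc)
  qed (auto simp: eqs Q.l_distr Q.r_distr)
qed

lemma smult_quotient_algebra:
  fixes A :: "('k, 'a) module"
  assumes "ideal I A" and x: "x \<in> carrier A"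
    and closed: "\<And>y. y \<in> carrier A \<Longrightarrow> c \<odot>\<^bsub>A\<^esub> y \<in> carrier A"
    and add: "\<And>y z. y \<in> carrier A \<Longrightarrow> z \<in> carrier A \<Longrightarrow>
      c \<odot>\<^bsub>A\<^esub> (y \<oplus>\<^bsub>A\<^esub> z) = c \<odot>\<^bsub>A\<^esub> y \<oplus>\<^bsub>A\<^esub> c \<odot>\<^bsub>A\<^esub> z"
    and mult: "\<And>y z. y \<in> carrier A \<Longrightarrow> z \<in> carrier A \<Longrightarrow>
      (c \<odot>\<^bsub>A\<^esub> y) \<otimes>\<^bsub>A\<^esub> z = c \<odot>\<^bsub>A\<^esub> (y \<otimes>\<^bsub>A\<^esub> z)"
  shows "c \<odot>\<^bsub>quotient_algebra A I\<^esub> (I +>\<^bsub>A\<^esub> x) = I +>\<^bsub>A\<^esub> (c \<odot>\<^bsub>A\<^esub> x)"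
proof -
  interpret ideal I A by fact
  have "I +>\<^bsub>A\<^esub> (c \<odot>\<^bsub>A\<^esub> u) = I +>\<^bsub>A\<^esub> (c \<odot>\<^bsub>A\<^esub> x)" if "u \<in> I +>\<^bsub>A\<^esub> x" for u
  proof -
    obtain i where i: "i \<in> I" "u = i \<oplus>\<^bsub>A\<^esub> x"
      using \<open>u \<in> I +>\<^bsub>A\<^esub> x\<close> by (auto simp: a_r_coset_def')
    have "c \<odot>\<^bsub>A\<^esub> i = (c \<odot>\<^bsub>A\<^esub> \<one>\<^bsub>A\<^esub>) \<otimes>\<^bsub>A\<^esub> i"
      using i by (simp add: mult a_Hcarr)
    then have "c \<odot>\<^bsub>A\<^esub> i \<in> I"
      using i by (simp add: I_l_closed closed)
    then have "c \<odot>\<^bsub>A\<^esub> u \<in> I +>\<^bsub>A\<^esub> (c \<odot>\<^bsub>A\<^esub> x)"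
      using i x by (auto simp: a_r_coset_def' add a_Hcarr)
    then show ?thesis
      using a_repr_independence[OF _ closed[OF x] a_subgroup] by simp
  qed
  moreover have "x \<in> I +>\<^bsub>A\<^esub> x"
    by (rule a_rcos_self[OF x])
  ultimately have "(\<Union>u\<in>I +>\<^bsub>A\<^esub> x. I +>\<^bsub>A\<^esub> (c \<odot>\<^bsub>A\<^esub> u)) = I +>\<^bsub>A\<^esub> (c \<odot>\<^bsub>A\<^esub> x)"
    by blast
  then show ?thesis
    by (simp add: quotient_algebra_def ring.defs module.defs)
qed


section \<open>Free algebras\<close>

text \<open>
  Lists form the free monoid, written additively because \<^typ>\<open>'a \<Rightarrow>\<^sub>0 'k\<close> is the monoid algebra of
  an additive monoid. Hence \<^typ>\<open>'x list \<Rightarrow>\<^sub>0 'k\<close> is the free algebra on the type \<open>'x\<close>.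
\<close>

instantiation list :: (type) monoid_add
begin

definition zero_list :: "'a list" where "zero_list = []"

definition plus_list :: "'a list \<Rightarrow> 'a list \<Rightarrow> 'a list" where "plus_list = (@)"

instance
  by standard (simp_all add: zero_list_def plus_list_def)

end

abbreviation scalar :: "'k::field \<Rightarrow> ('x list \<Rightarrow>\<^sub>0 'k)" where
  "scalar c \<equiv> Poly_Mapping.single [] c"

abbreviation variable :: "'x \<Rightarrow> ('x list \<Rightarrow>\<^sub>0 'k::field)" where
  "variable x \<equiv> Poly_Mapping.single [x] 1"

definition free_algebra :: "'x set \<Rightarrow> ('k::field, 'x list \<Rightarrow>\<^sub>0 'k) module" where
  "free_algebra V =
    \<lparr>carrier = {p. \<forall>w\<in>Poly_Mapping.keys p. set w \<subseteq> V}, monoid.mult = (*), one = 1,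
     zero = 0, add = (+), smult = (\<lambda>c p. scalar c * p)\<rparr>"

lemma ring_free_algebra: "ring (free_algebra V :: ('k::field, 'x list \<Rightarrow>\<^sub>0 'k) module)"
proof (rule ringI)
  let ?A = "free_algebra V :: ('k, 'x list \<Rightarrow>\<^sub>0 'k) module"
  have times: "p \<otimes>\<^bsub>?A\<^esub> r \<in> carrier ?A" if "p \<in> carrier ?A" "r \<in> carrier ?A" for p r
    using that keys_mult[of p r] by (fastforce simp: free_algebra_def plus_list_def)
  have plus: "p \<oplus>\<^bsub>?A\<^esub> r \<in> carrier ?A" if "p \<in> carrier ?A" "r \<in> carrier ?A" for p r
    using that Poly_Mapping.keys_add[of p r] by (fastforce simp: free_algebra_def)
  show "abelian_group ?A"
  proof (rule abelian_groupI)
    fix p assume "p \<in> carrier ?A"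
    then have "- p \<in> carrier ?A" "- p \<oplus>\<^bsub>?A\<^esub> p = \<zero>\<^bsub>?A\<^esub>"
      by (auto simp: free_algebra_def)
    then show "\<exists>r\<in>carrier ?A. r \<oplus>\<^bsub>?A\<^esub> p = \<zero>\<^bsub>?A\<^esub>" by blast
  qed (simp_all add: plus, simp_all add: free_algebra_def add_ac)
  show "Group.monoid ?A"
    by (rule monoidI) (simp_all add: times, simp_all add: free_algebra_def mult.assoc zero_list_def)
qed (simp_all add: free_algebra_def distrib_left distrib_right)


section \<open>The length function on the symmetric group\<close>

text \<open>
  The Coxeter length of a permutation of \<open>{1..m}\<close>: the least number of adjacent transpositions
  \<open>(i i+1)\<close>, \<open>1 \<le> i < m\<close>, whose product it is.
\<close>

definition perm_length :: "nat \<Rightarrow> (nat \<Rightarrow> nat) \<Rightarrow> nat" where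
  "perm_length m \<sigma> =
    (LEAST l. \<exists>is. length is = l \<and> set is \<subseteq> {1..<m} \<and>
       \<sigma> = foldr (\<lambda>i \<tau>. transpose i (Suc i) \<circ> \<tau>) is id)"


section \<open>Quantized coordinate rings\<close>

type_synonym 'k fa = "(nat \<times> nat) list \<Rightarrow>\<^sub>0 'k"

abbreviation X :: "nat \<Rightarrow> nat \<Rightarrow> 'k::field fa" where
  "X i j \<equiv> variable (i, j)"

abbreviation matrix_free_algebra :: "nat \<Rightarrow> ('k::field, 'k fa) module" where
  "matrix_free_algebra n \<equiv> free_algebra ({1..n+1} \<times> {1..n+1})"

definition quantum_det :: "nat \<Rightarrow> 'k::field \<Rightarrow> 'k fa" where
  "quantum_det n q =
    (\<Sum>\<sigma> | \<sigma> permutes {1..n+1}.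
       scalar ((- q) ^ perm_length (n+1) \<sigma>) * (\<Prod>i\<leftarrow>[1..<n+2]. X i (\<sigma> i)))"

definition SL_relators :: "nat \<Rightarrow> 'k::field \<Rightarrow> 'k fa set" where
  "SL_relators n q =
    {X i j * X i m - scalar q * X i m * X i j | i j m.
       i \<in> {1..n+1} \<and> j \<in> {1..n+1} \<and> m \<in> {1..n+1} \<and> j < m} \<union>
    {X i j * X l j - scalar q * X l j * X i j | i j l.
       i \<in> {1..n+1} \<and> j \<in> {1..n+1} \<and> l \<in> {1..n+1} \<and> i < l} \<union>
    {X i j * X l m - X l m * X i j | i j l m.
       i \<in> {1..n+1} \<and> j \<in> {1..n+1} \<and> l \<in> {1..n+1} \<and> m \<in> {1..n+1} \<and> i < l \<and> j > m} \<union>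
    {X i j * X l m - X l m * X i j - scalar (q - inverse q) * X i m * X l j | i j l m.
       i \<in> {1..n+1} \<and> j \<in> {1..n+1} \<and> l \<in> {1..n+1} \<and> m \<in> {1..n+1} \<and> i < l \<and> j < m} \<union>
    {quantum_det n q - 1}"

text \<open>\<^const>\<open>genideal\<close> is meaningful only for subsets of the carrier.\<close>

lemma SL_relators_carrier:
  fixes q :: "'k::field"
  shows "SL_relators n q \<subseteq> carrier (matrix_free_algebra n)"
proof -
  let ?A = "matrix_free_algebra n :: ('k, 'k fa) module"
  have carr: "p \<in> carrier ?A \<longleftrightarrow>
      (\<forall>w\<in>Poly_Mapping.keys p. set w \<subseteq> {1..n+1} \<times> {1..n+1})" for p
    by (simp add: free_algebra_def)
  have times: "p * r \<in> carrier ?A" if "p \<in> carrier ?A" "r \<in> carrier ?A" for p r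
    using ring.ring_simprules(5)[OF ring_free_algebra that] by (simp add: free_algebra_def)
  have plus: "p + r \<in> carrier ?A" if "p \<in> carrier ?A" "r \<in> carrier ?A" for p r
    using ring.ring_simprules(1)[OF ring_free_algebra that] by (simp add: free_algebra_def)
  have minus: "p - r \<in> carrier ?A" if "p \<in> carrier ?A" "r \<in> carrier ?A" for p r
    using that Poly_Mapping.keys_diff[of p r] unfolding carr by blast
  have X: "X i j \<in> carrier ?A" if "i \<in> {1..n+1}" "j \<in> {1..n+1}" for i j
    using that unfolding carr by simp
  have scalar: "scalar c \<in> carrier ?A" for c
    unfolding carr by simp
  have one: "1 \<in> carrier ?A" and zero: "0 \<in> carrier ?A"
    by (simp_all add: free_algebra_def zero_list_def)
  have prod: "(\<Prod>i\<leftarrow>is. X i (\<sigma> i)) \<in> carrier ?A"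
    if "\<sigma> permutes {1..n+1}" "set is \<subseteq> {1..n+1}" for \<sigma> "is"
    using that(2)
  proof (induction "is")
    case (Cons i "is")
    then have "i \<in> {1..n+1}" "\<sigma> i \<in> {1..n+1}"
      using permutes_in_image[OF that(1), of i] by auto
    then have "X i (\<sigma> i) * (\<Prod>i\<leftarrow>is. X i (\<sigma> i)) \<in> carrier ?A"
      using Cons by (intro times X) auto
    then show ?case by simp
  qed (use one in simp)
  have sum: "sum f S \<in> carrier ?A" if "\<And>s. s \<in> S \<Longrightarrow> f s \<in> carrier ?A"
    for f and S :: "(nat \<Rightarrow> nat) set"
    using that by (induction S rule: infinite_finite_induct)
      (auto intro: zero plus simp del: One_nat_def)
  have "quantum_det n q \<in> carrier ?A"
    unfolding quantum_det_def by (intro sum times scalar prod) auto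
  then show ?thesis
    unfolding SL_relators_def by (auto intro!: minus times scalar X one simp del: atLeastAtMost_iff One_nat_def)
qed

definition SL_ideal :: "nat \<Rightarrow> 'k::field \<Rightarrow> 'k fa set" where
  "SL_ideal n q = genideal (matrix_free_algebra n) (SL_relators n q)"

lemma ideal_SL_ideal: "ideal (SL_ideal n q) (matrix_free_algebra n)"
  unfolding SL_ideal_def by (rule ring.genideal_ideal[OF ring_free_algebra SL_relators_carrier])

definition Oq_SL :: "nat \<Rightarrow> 'k::field \<Rightarrow> ('k, 'k fa set) module" where
  "Oq_SL n q = quotient_algebra (matrix_free_algebra n) (SL_ideal n q)"

definition X_SL :: "nat \<Rightarrow> 'k::field \<Rightarrow> nat \<Rightarrow> nat \<Rightarrow> 'k fa set" where
  "X_SL n q i j = SL_ideal n q +>\<^bsub>matrix_free_algebra n\<^esub> X i j"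

lemma ring_Oq_SL: "ring (Oq_SL n q)"
  unfolding Oq_SL_def by (rule ring_quotient_algebra[OF ideal_SL_ideal])

lemma X_SL_carrier:
  assumes "i \<in> {1..n+1}" "j \<in> {1..n+1}"
  shows "X_SL n q i j \<in> carrier (Oq_SL n q)"
proof -
  have "X i j \<in> carrier (matrix_free_algebra n)"
    using assms by (simp add: free_algebra_def)
  then show ?thesis
    unfolding X_SL_def Oq_SL_def quotient_algebra_def FactRing_def A_RCOSETS_def'
    by (auto simp: ring.defs)
qed

definition Bplus_ideal :: "nat \<Rightarrow> 'k::field \<Rightarrow> 'k fa set set" where
  "Bplus_ideal n q =
    genideal (Oq_SL n q) {X_SL n q i j | i j. i \<in> {1..n+1} \<and> j \<in> {1..n+1} \<and> i > j}"

definition Bminus_ideal :: "nat \<Rightarrow> 'k::field \<Rightarrow> 'k fa set set" where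
  "Bminus_ideal n q =
    genideal (Oq_SL n q) {X_SL n q i j | i j. i \<in> {1..n+1} \<and> j \<in> {1..n+1} \<and> i < j}"

lemma ideal_Bplus_ideal: "ideal (Bplus_ideal n q) (Oq_SL n q)"
  unfolding Bplus_ideal_def
  by (rule ring.genideal_ideal[OF ring_Oq_SL]) (use X_SL_carrier in blast)

lemma ideal_Bminus_ideal: "ideal (Bminus_ideal n q) (Oq_SL n q)"
  unfolding Bminus_ideal_def
  by (rule ring.genideal_ideal[OF ring_Oq_SL]) (use X_SL_carrier in blast)

definition Oq_Bplus :: "nat \<Rightarrow> 'k::field \<Rightarrow> ('k, 'k fa set set) module" where
  "Oq_Bplus n q = quotient_algebra (Oq_SL n q) (Bplus_ideal n q)"

definition Oq_Bminus :: "nat \<Rightarrow> 'k::field \<Rightarrow> ('k, 'k fa set set) module" where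
  "Oq_Bminus n q = quotient_algebra (Oq_SL n q) (Bminus_ideal n q)"

definition X_Bplus :: "nat \<Rightarrow> 'k::field \<Rightarrow> nat \<Rightarrow> nat \<Rightarrow> 'k fa set set" where
  "X_Bplus n q i j = Bplus_ideal n q +>\<^bsub>Oq_SL n q\<^esub> X_SL n q i j"

definition X_Bminus :: "nat \<Rightarrow> 'k::field \<Rightarrow> nat \<Rightarrow> nat \<Rightarrow> 'k fa set set" where
  "X_Bminus n q i j = Bminus_ideal n q +>\<^bsub>Oq_SL n q\<^esub> X_SL n q i j"

definition Oq_Nplus :: "nat \<Rightarrow> 'k::field \<Rightarrow> ('k, 'k fa set set) module" where
  "Oq_Nplus n q = generated_subalgebra (Oq_Bplus n q)
    {inv\<^bsub>Oq_Bplus n q\<^esub> X_Bplus n q i i \<otimes>\<^bsub>Oq_Bplus n q\<^esub> X_Bplus n q i j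
      | i j. 1 \<le> i \<and> i < j \<and> j \<le> n+1}"

definition Oq_Nplus' :: "nat \<Rightarrow> 'k::field \<Rightarrow> ('k, 'k fa set set) module" where
  "Oq_Nplus' n q = generated_subalgebra (Oq_Bplus n q)
    {X_Bplus n q i j \<otimes>\<^bsub>Oq_Bplus n q\<^esub> inv\<^bsub>Oq_Bplus n q\<^esub> X_Bplus n q j j
      | i j. 1 \<le> i \<and> i < j \<and> j \<le> n+1}"

definition Oq_Nminus :: "nat \<Rightarrow> 'k::field \<Rightarrow> ('k, 'k fa set set) module" where
  "Oq_Nminus n q = generated_subalgebra (Oq_Bminus n q)
    {inv\<^bsub>Oq_Bminus n q\<^esub> X_Bminus n q j j \<otimes>\<^bsub>Oq_Bminus n q\<^esub> X_Bminus n q j i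
      | i j. 1 \<le> i \<and> i < j \<and> j \<le> n+1}"

definition Oq_Nminus' :: "nat \<Rightarrow> 'k::field \<Rightarrow> ('k, 'k fa set set) module" where
  "Oq_Nminus' n q = generated_subalgebra (Oq_Bminus n q)
    {X_Bminus n q j i \<otimes>\<^bsub>Oq_Bminus n q\<^esub> inv\<^bsub>Oq_Bminus n q\<^esub> X_Bminus n q i i
      | i j. 1 \<le> i \<and> i < j \<and> j \<le> n+1}"

end

theory Submission
  imports Defs
begin

text \<open>
  Transposition \<open>X\<^sub>i\<^sub>j \<mapsto> X\<^sub>j\<^sub>i\<close> identifies \<open>O\<^sub>q(B\<^sup>+)\<close> with \<open>O\<^sub>q(B\<^sup>-)\<close>, because for triangular matrices
  the quantum determinant is the product of the diagonal. Up to powers of \<open>q\<close> it carries the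
  generators of \<open>O\<^sub>q(N\<^sup>+)\<close> to those of \<open>O\<^sub>q(N\<^sup>-)'\<close> and those of \<open>O\<^sub>q(N\<^sup>+)'\<close> to those of \<open>O\<^sub>q(N\<^sup>-)\<close>.
  It remains to compare \<open>O\<^sub>q(N\<^sup>+)\<close> and \<open>O\<^sub>q(N\<^sup>+)'\<close>. Let \<open>X\<^sub>i\<^sub>j\<close> have weight \<open>v = \<epsilon>\<^sub>i - \<epsilon>\<^sub>j\<close> and let
  \<open>t\<^sup>v = X\<^sub>i\<^sub>i X\<^sub>j\<^sub>j\<close> (second factor inverted) be the corresponding torus element, so that
  \<open>t\<^sup>v y = q\<^bsup>(v,w)\<^esup> y t\<^sup>v\<close> for \<open>y\<close> of weight \<open>w\<close>. Since \<open>(v,v)\<close> is even on the root lattice,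
  \<open>y \<mapsto> q\<^bsup>-(v,v)/2\<^esup> t\<^sup>v y\<close> on the part of weight \<open>v\<close> is an algebra automorphism of \<open>O\<^sub>q(B\<^sup>+)\<close>,
  and it maps the generators of \<open>O\<^sub>q(N\<^sup>+)\<close> to those of \<open>O\<^sub>q(N\<^sup>+)'\<close>.
\<close>

section \<open>Algebra homomorphisms and generated subalgebras\<close>

text \<open>Scalars range over the whole type \<open>'k\<close>, so no carrier condition is put on
  them. The last two axioms make scalars central, which lets powers of \<open>q\<close> be collected
  in front of any product.\<close>

locale unital_algebra = ring A for A :: "('k::field, 'a) module" (structure) +
  assumes smult_closed [intro, simp]: "x \<in> carrier A \<Longrightarrow> c \<odot> x \<in> carrier A"
    and smult_l_distr: "x \<in> carrier A \<Longrightarrow> (c + d) \<odot> x = c \<odot> x \<oplus> d \<odot> x"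
    and smult_r_distr: "x \<in> carrier A \<Longrightarrow> y \<in> carrier A \<Longrightarrow> c \<odot> (x \<oplus> y) = c \<odot> x \<oplus> c \<odot> y"
    and smult_smult [simp]: "x \<in> carrier A \<Longrightarrow> c \<odot> (d \<odot> x) = (c * d) \<odot> x"
    and smult_one [simp]: "x \<in> carrier A \<Longrightarrow> 1 \<odot> x = x"
    and smult_mult_left [simp]:
      "x \<in> carrier A \<Longrightarrow> y \<in> carrier A \<Longrightarrow> (c \<odot> x) \<otimes> y = c \<odot> (x \<otimes> y)"
    and smult_mult_right [simp]:
      "x \<in> carrier A \<Longrightarrow> y \<in> carrier A \<Longrightarrow> x \<otimes> (c \<odot> y) = c \<odot> (x \<otimes> y)"
begin

lemma smult_zero_left [simp]: "x \<in> carrier A \<Longrightarrow> 0 \<odot> x = \<zero>"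
  using smult_l_distr[of x 0 0] by (simp add: local.add.l_cancel_one')

lemma smult_zero_right [simp]: "c \<odot> \<zero> = \<zero>"
  using smult_r_distr[of \<zero> \<zero> c] by (simp add: local.add.l_cancel_one')

text \<open>Since \<open>G\<close> lies in \<open>carrier A\<close>, the intersected family contains
  \<open>carrier A\<close> and is nonempty; the intersection is therefore a genuine subring of
  \<open>A\<close>.\<close>

lemma subalgebra_Inter:
  assumes "G \<subseteq> carrier A"
  shows "is_unital_subalgebra (\<Inter> {S. is_unital_subalgebra S A \<and> G \<subseteq> S}) A"
proof -
  have "is_unital_subalgebra (carrier A) A"
    by (simp add: is_unital_subalgebra_def carrier_is_subring)
  then have "subring (\<Inter> {S. is_unital_subalgebra S A \<and> G \<subseteq> S}) A"
    using assms by (intro subring_Inter) (auto simp: is_unital_subalgebra_def)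
  then show ?thesis
    by (auto simp: is_unital_subalgebra_def)
qed

end

lemma algebra_homD:
  assumes "h \<in> algebra_hom A B"
  shows algebra_hom_closed: "x \<in> carrier A \<Longrightarrow> h x \<in> carrier B"
    and algebra_hom_add: "x \<in> carrier A \<Longrightarrow> y \<in> carrier A \<Longrightarrow> h (x \<oplus>\<^bsub>A\<^esub> y) = h x \<oplus>\<^bsub>B\<^esub> h y"
    and algebra_hom_mult: "x \<in> carrier A \<Longrightarrow> y \<in> carrier A \<Longrightarrow> h (x \<otimes>\<^bsub>A\<^esub> y) = h x \<otimes>\<^bsub>B\<^esub> h y"
    and algebra_hom_one: "h \<one>\<^bsub>A\<^esub> = \<one>\<^bsub>B\<^esub>"
    and algebra_hom_smult: "x \<in> carrier A \<Longrightarrow> h (c \<odot>\<^bsub>A\<^esub> x) = c \<odot>\<^bsub>B\<^esub> h x"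
  using assms by (auto simp: algebra_hom_def ring_hom_def)

lemma algebra_homI:
  assumes "\<And>x. x \<in> carrier A \<Longrightarrow> h x \<in> carrier B"
    and "\<And>x y. x \<in> carrier A \<Longrightarrow> y \<in> carrier A \<Longrightarrow> h (x \<oplus>\<^bsub>A\<^esub> y) = h x \<oplus>\<^bsub>B\<^esub> h y"
    and "\<And>x y. x \<in> carrier A \<Longrightarrow> y \<in> carrier A \<Longrightarrow> h (x \<otimes>\<^bsub>A\<^esub> y) = h x \<otimes>\<^bsub>B\<^esub> h y"
    and "h \<one>\<^bsub>A\<^esub> = \<one>\<^bsub>B\<^esub>"
    and "\<And>x c. x \<in> carrier A \<Longrightarrow> h (c \<odot>\<^bsub>A\<^esub> x) = c \<odot>\<^bsub>B\<^esub> h x"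
  shows "h \<in> algebra_hom A B"
  using assms by (auto simp: algebra_hom_def ring_hom_def)

lemma algebra_hom_comp:
  assumes "f \<in> algebra_hom A B" "g \<in> algebra_hom B C"
  shows "g \<circ> f \<in> algebra_hom A C"
  by (rule algebra_homI) (simp_all add: algebra_homD[OF assms(1)] algebra_homD[OF assms(2)])

lemma algebra_hom_ring_hom_ring:
  assumes "unital_algebra A" "unital_algebra B" "h \<in> algebra_hom A B"
  shows "ring_hom_ring A B h"
  using assms by (simp add: ring_hom_ring_def ring_hom_ring_axioms_def unital_algebra_def algebra_hom_def)

lemma algebra_hom_inv:
  assumes "unital_algebra A" "unital_algebra B" "h \<in> algebra_hom A B" "x \<in> Units A"
  shows "h (inv\<^bsub>A\<^esub> x) = inv\<^bsub>B\<^esub> (h x)"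
proof -
  interpret A: unital_algebra A by fact
  interpret B: unital_algebra B by fact
  note h = algebra_homD[OF assms(3)]
  have x: "x \<in> carrier A" "inv\<^bsub>A\<^esub> x \<in> carrier A" using assms(4) by auto
  show ?thesis
    by (rule B.inv_unique')
      (use x assms(4) in \<open>simp_all add: h(1) flip: h(3) h(4)\<close>)
qed

text \<open>Used to show that a homomorphism maps one generated subalgebra into another: the
  preimage of the target is a subalgebra, so it only has to contain the generators.\<close>

lemma subalgebra_vimage:
  assumes "unital_algebra A" "unital_algebra B" "h \<in> algebra_hom A B" "is_unital_subalgebra S B"
  shows "is_unital_subalgebra {x \<in> carrier A. h x \<in> S} A"
proof -
  interpret A: unital_algebra A by fact
  interpret B: unital_algebra B by fact
  interpret ring_hom_ring A B h by (rule algebra_hom_ring_hom_ring[OF assms(1-3)])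
  have S: "subring S B" "\<And>c x. x \<in> S \<Longrightarrow> c \<odot>\<^bsub>B\<^esub> x \<in> S"
    using assms(4) by (auto simp: is_unital_subalgebra_def)
  note S' = subringE[OF S(1)]
  have "subring {x \<in> carrier A. h x \<in> S} A"
    by (rule A.subringI) (use S' in auto)
  then show ?thesis
    using S(2) algebra_hom_smult[OF assms(3)] by (auto simp: is_unital_subalgebra_def)
qed

text \<open>Lets two homomorphisms that agree on generators be identified on everything generated by
  them; below one of the two is the identity.\<close>

lemma subalgebra_equalizer:
  assumes "unital_algebra A" "unital_algebra B" "f \<in> algebra_hom A B" "g \<in> algebra_hom A B"
  shows "is_unital_subalgebra {x \<in> carrier A. f x = g x} A"
proof -
  interpret A: unital_algebra A by fact
  interpret F: ring_hom_ring A B f by (rule algebra_hom_ring_hom_ring[OF assms(1-3)])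
  interpret G: ring_hom_ring A B g by (rule algebra_hom_ring_hom_ring[OF assms(1,2,4)])
  have "subring {x \<in> carrier A. f x = g x} A"
    by (rule A.subringI) auto
  then show ?thesis
    using algebra_hom_smult[OF assms(3)] algebra_hom_smult[OF assms(4)]
    by (auto simp: is_unital_subalgebra_def)
qed

section \<open>Isomorphisms of generated subalgebras, checked on generators\<close>

lemma generated_subalgebra_incl:
  "G \<subseteq> carrier (generated_subalgebra A G)"
  by (auto simp: generated_subalgebra_def)

lemma generated_subalgebra_minimal:
  "is_unital_subalgebra S A \<Longrightarrow> G \<subseteq> S \<Longrightarrow> carrier (generated_subalgebra A G) \<subseteq> S"
  by (auto simp: generated_subalgebra_def)

text \<open>Needed where a homomorphism meets a generator only up to a power of
  \<open>q\<close>.\<close>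

lemma smult_in_generated_subalgebra:
  "g \<in> G \<Longrightarrow> c \<odot>\<^bsub>A\<^esub> g \<in> carrier (generated_subalgebra A G)"
  by (auto simp: generated_subalgebra_def is_unital_subalgebra_def)

text \<open>Inclusions into preimages and equalizers spread from the generators to the generated
  subalgebras, so \<open>f\<close> and \<open>g\<close> restrict to mutually inverse maps there.
  They are not assumed to be inverse to each other on all of \<open>A\<close> and
  \<open>B\<close>.\<close>

lemma algebra_isomorphic_generated:
  assumes A: "unital_algebra A" and B: "unital_algebra B"
    and f: "f \<in> algebra_hom A B" and g: "g \<in> algebra_hom B A"
    and G: "G \<subseteq> carrier A" and H: "H \<subseteq> carrier B"
    and fG: "\<And>x. x \<in> G \<Longrightarrow> f x \<in> carrier (generated_subalgebra B H) \<and> g (f x) = x"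
    and gH: "\<And>x. x \<in> H \<Longrightarrow> g x \<in> carrier (generated_subalgebra A G) \<and> f (g x) = x"
  shows "algebra_isomorphic (generated_subalgebra A G) (generated_subalgebra B H)"
proof -
  interpret A: unital_algebra A by fact
  interpret B: unital_algebra B by fact
  let ?G = "carrier (generated_subalgebra A G)" and ?H = "carrier (generated_subalgebra B H)"
  have subG: "is_unital_subalgebra ?G A" and subH: "is_unital_subalgebra ?H B"
    using A.subalgebra_Inter[OF G] B.subalgebra_Inter[OF H]
    by (simp_all add: generated_subalgebra_def)
  have GA: "?G \<subseteq> carrier A" and HB: "?H \<subseteq> carrier B"
    using subG subH by (auto simp: is_unital_subalgebra_def dest: subringE(1))
  have ida: "id \<in> algebra_hom A A" and idb: "id \<in> algebra_hom B B"
    by (auto intro: algebra_homI)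
  have 1: "?G \<subseteq> {x \<in> carrier A. f x \<in> ?H}"
    by (rule generated_subalgebra_minimal[OF subalgebra_vimage[OF A B f subH]]) (use G fG in auto)
  have 2: "?H \<subseteq> {x \<in> carrier B. g x \<in> ?G}"
    by (rule generated_subalgebra_minimal[OF subalgebra_vimage[OF B A g subG]]) (use H gH in auto)
  have 3: "?G \<subseteq> {x \<in> carrier A. (g \<circ> f) x = id x}"
    by (rule generated_subalgebra_minimal[OF subalgebra_equalizer[OF A A algebra_hom_comp[OF f g] ida]])
      (use G fG in auto)
  have 4: "?H \<subseteq> {x \<in> carrier B. (f \<circ> g) x = id x}"
    by (rule generated_subalgebra_minimal[OF subalgebra_equalizer[OF B B algebra_hom_comp[OF g f] idb]])
      (use H gH in auto)
  have "bij_betw f ?G ?H"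
    by (rule bij_betw_byWitness[where f' = g]) (use 1 2 3 4 in auto)
  moreover have "f \<in> algebra_hom (generated_subalgebra A G) (generated_subalgebra B H)"
  proof (rule algebra_homI)
    show "f x \<in> ?H" if "x \<in> ?G" for x using 1 that by auto
  qed (use GA in \<open>auto simp: algebra_homD[OF f] generated_subalgebra_def subset_iff\<close>)
  ultimately show ?thesis
    unfolding algebra_isomorphic_def by blast
qed

lemma algebra_isomorphic_refl: "algebra_isomorphic A A"
proof -
  have "id \<in> algebra_hom A A" by (auto intro: algebra_homI)
  then show ?thesis unfolding algebra_isomorphic_def using bij_betw_id by blast
qed

lemma algebra_isomorphic_trans:
  "algebra_isomorphic A B \<Longrightarrow> algebra_isomorphic B C \<Longrightarrow> algebra_isomorphic A C"
  unfolding algebra_isomorphic_def using algebra_hom_comp bij_betw_trans by blast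

section \<open>Quotient algebras\<close>

lemma quotient_algebra_simps:
  "carrier (quotient_algebra A I) = a_rcosets\<^bsub>A\<^esub> I"
  "x \<otimes>\<^bsub>quotient_algebra A I\<^esub> y = rcoset_mult A I x y"
  "\<one>\<^bsub>quotient_algebra A I\<^esub> = I +>\<^bsub>A\<^esub> \<one>\<^bsub>A\<^esub>"
  "\<zero>\<^bsub>quotient_algebra A I\<^esub> = I"
  "x \<oplus>\<^bsub>quotient_algebra A I\<^esub> y = x <+>\<^bsub>A\<^esub> y"
  by (simp_all add: quotient_algebra_def FactRing_def ring.defs)

context unital_algebra
begin

lemma quotient_algebra_smult:
  assumes "ideal I A" "x \<in> carrier A"
  shows "c \<odot>\<^bsub>quotient_algebra A I\<^esub> (I +> x) = I +> (c \<odot> x)"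
  by (rule smult_quotient_algebra[OF assms]) (simp_all add: smult_r_distr)

lemma quotient_map_hom:
  assumes "ideal I A"
  shows "(\<lambda>x. I +> x) \<in> algebra_hom A (quotient_algebra A I)"
proof -
  interpret I: ideal I A by fact
  show ?thesis
    using I.rcos_ring_hom quotient_algebra_smult[OF assms]
    by (intro algebra_homI) (auto simp: quotient_algebra_simps ring_hom_def FactRing_def)
qed

lemma quotient_carrier: "carrier (quotient_algebra A I) = (\<lambda>x. I +> x) ` carrier A"
  by (auto simp: quotient_algebra_simps A_RCOSETS_def')

text \<open>Each axiom holds for representatives in \<open>A\<close> and is carried over by the
  coset map, which is surjective and compatible with all operations.\<close>

lemma unital_algebra_quotient:
  assumes "ideal I A"
  shows "unital_algebra (quotient_algebra A I)"
proof -
  interpret Q: ring "quotient_algebra A I" by (rule ring_quotient_algebra[OF assms])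
  note h = algebra_homD[OF quotient_map_hom[OF assms]]
  have rep: "\<exists>y\<in>carrier A. x = I +> y" if "x \<in> carrier (quotient_algebra A I)" for x
    using that by (auto simp: quotient_carrier)
  show ?thesis
  proof
    fix c d x assume "x \<in> carrier (quotient_algebra A I)"
    then obtain x' where x: "x' \<in> carrier A" "x = I +> x'" using rep by blast
    show "c \<odot>\<^bsub>quotient_algebra A I\<^esub> x \<in> carrier (quotient_algebra A I)"
      unfolding x(2) h(5)[OF x(1), symmetric] using x(1) by (simp add: h(1))
    show "(c + d) \<odot>\<^bsub>quotient_algebra A I\<^esub> x =
      c \<odot>\<^bsub>quotient_algebra A I\<^esub> x \<oplus>\<^bsub>quotient_algebra A I\<^esub> d \<odot>\<^bsub>quotient_algebra A I\<^esub> x"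
      unfolding x(2) h(5)[OF x(1), symmetric] using x(1) by (simp add: smult_l_distr h(2))
    show "c \<odot>\<^bsub>quotient_algebra A I\<^esub> (d \<odot>\<^bsub>quotient_algebra A I\<^esub> x) =
      (c * d) \<odot>\<^bsub>quotient_algebra A I\<^esub> x"
      using x(1) by (simp add: x(2) flip: h(5))
    show "1 \<odot>\<^bsub>quotient_algebra A I\<^esub> x = x"
      using x(1) by (simp add: x(2) flip: h(5))
  next
    fix c x y assume "x \<in> carrier (quotient_algebra A I)" "y \<in> carrier (quotient_algebra A I)"
    then obtain x' y' where xy: "x' \<in> carrier A" "x = I +> x'" "y' \<in> carrier A" "y = I +> y'"
      using rep by blast
    show "c \<odot>\<^bsub>quotient_algebra A I\<^esub> (x \<oplus>\<^bsub>quotient_algebra A I\<^esub> y) =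
      c \<odot>\<^bsub>quotient_algebra A I\<^esub> x \<oplus>\<^bsub>quotient_algebra A I\<^esub> c \<odot>\<^bsub>quotient_algebra A I\<^esub> y"
      using xy(1,3) by (simp add: xy(2,4) smult_r_distr flip: h(2,5))
    show "c \<odot>\<^bsub>quotient_algebra A I\<^esub> x \<otimes>\<^bsub>quotient_algebra A I\<^esub> y =
      c \<odot>\<^bsub>quotient_algebra A I\<^esub> (x \<otimes>\<^bsub>quotient_algebra A I\<^esub> y)"
      using xy(1,3) by (simp add: xy(2,4) flip: h(3,5))
    show "x \<otimes>\<^bsub>quotient_algebra A I\<^esub> (c \<odot>\<^bsub>quotient_algebra A I\<^esub> y) =
      c \<odot>\<^bsub>quotient_algebra A I\<^esub> (x \<otimes>\<^bsub>quotient_algebra A I\<^esub> y)"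
      using xy(1,3) by (simp add: xy(2,4) flip: h(3,5))
  qed
qed

lemma quotient_lift:
  assumes I: "ideal I A" and B: "unital_algebra B" and h: "h \<in> algebra_hom A B"
    and zero: "\<And>x. x \<in> I \<Longrightarrow> h x = \<zero>\<^bsub>B\<^esub>"
  obtains g where "g \<in> algebra_hom (quotient_algebra A I) B"
    "\<And>x. x \<in> carrier A \<Longrightarrow> g (I +> x) = h x"
proof -
  interpret I: ideal I A by fact
  interpret h: ring_hom_ring A B h
    by (rule algebra_hom_ring_hom_ring[OF unital_algebra_axioms B h])
  \<comment> \<open>Any element of a coset may serve as its representative: two of them differ by an
    element of \<open>I\<close>, which \<open>h\<close> kills.\<close>
  define g where "g U = h (SOME x. x \<in> U)" for U
  have g: "g (I +> x) = h x" if x: "x \<in> carrier A" for x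
  proof -
    have "(SOME y. y \<in> I +> x) \<in> I +> x"
      using I.a_rcos_self[OF x] by (rule someI)
    then obtain i where "i \<in> I" "(SOME y. y \<in> I +> x) = i \<oplus> x"
      by (auto simp: a_r_coset_def')
    then show ?thesis
      using x zero by (simp add: g_def I.a_Hcarr)
  qed
  note p = algebra_homD[OF quotient_map_hom[OF I]]
  have "g \<in> algebra_hom (quotient_algebra A I) B"
  proof (rule algebra_homI)
    show "g \<one>\<^bsub>quotient_algebra A I\<^esub> = \<one>\<^bsub>B\<^esub>"
      using g[of \<one>] by (simp flip: p(4))
  qed (auto simp: quotient_carrier g algebra_homD[OF h] simp flip: p(2,3,5))
  then show thesis using g that by blast
qed

text \<open>The kernel of \<open>h\<close> is an ideal, so it contains \<open>Idl R\<close> as soon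
  as it contains \<open>R\<close>; only the relators have to be checked.\<close>

lemma quotient_genideal_lift:
  assumes R: "R \<subseteq> carrier A" and B: "unital_algebra B" and h: "h \<in> algebra_hom A B"
    and zero: "\<And>x. x \<in> R \<Longrightarrow> h x = \<zero>\<^bsub>B\<^esub>"
  obtains g where "g \<in> algebra_hom (quotient_algebra A (Idl R)) B"
    "\<And>x. x \<in> carrier A \<Longrightarrow> g (Idl R +> x) = h x"
proof -
  interpret h: ring_hom_ring A B h
    by (rule algebra_hom_ring_hom_ring[OF unital_algebra_axioms B h])
  have "Idl R \<subseteq> a_kernel A B h"
    by (rule genideal_minimal[OF h.kernel_is_ideal]) (use R zero in \<open>unfold a_kernel_def', blast\<close>)
  then have "h x = \<zero>\<^bsub>B\<^esub>" if "x \<in> Idl R" for x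
    using that unfolding a_kernel_def' by blast
  then show thesis
    using quotient_lift[OF genideal_ideal[OF R] B h] that by blast
qed

lemma quotient_map_zero:
  assumes "ideal I A" "x \<in> I"
  shows "I +> x = \<zero>\<^bsub>quotient_algebra A I\<^esub>"
proof -
  interpret I: ideal I A by fact
  show ?thesis using assms(2) I.a_rcos_const by (simp add: quotient_algebra_simps)
qed

end

section \<open>Free algebras\<close>

lemma free_algebra_simps:
  "x \<otimes>\<^bsub>free_algebra V\<^esub> y = x * y" "\<one>\<^bsub>free_algebra V\<^esub> = 1" "\<zero>\<^bsub>free_algebra V\<^esub> = 0"
  "x \<oplus>\<^bsub>free_algebra V\<^esub> y = x + y" "c \<odot>\<^bsub>free_algebra V\<^esub> x = scalar c * x"
  by (simp_all add: free_algebra_def)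

lemma scalar_one: "scalar (1::'k::field) = (1 :: 'x list \<Rightarrow>\<^sub>0 'k)"
  by (metis single_one zero_list_def)

text \<open>In \<open>free_algebra\<close> a scalar acts by left multiplication with a constant, so
  taking it out of a right-hand factor requires constants to be central. The induction adds one
  monomial at a time.\<close>

lemma scalar_commute: "x * scalar c = scalar c * (x :: 'x list \<Rightarrow>\<^sub>0 'k::field)"
proof (induction x rule: update_induct)
  case (update f a b)
  have "Poly_Mapping.update a b f = Poly_Mapping.single a b + f"
    by (rule poly_mapping_eqI)
      (use update in \<open>auto simp: lookup_update lookup_add lookup_single in_keys_iff when_def\<close>)
  then show ?case
    using update by (simp add: distrib_left distrib_right mult_single plus_list_def mult.commute)
qed simp

lemma unital_algebra_free_algebra:
  "unital_algebra (free_algebra V :: ('k::field, 'x list \<Rightarrow>\<^sub>0 'k) module)"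
proof -
  interpret ring "free_algebra V :: ('k, 'x list \<Rightarrow>\<^sub>0 'k) module" by (rule ring_free_algebra)
  have sc: "scalar c \<in> carrier (free_algebra V)" for c :: 'k
    by (simp add: free_algebra_def)
  show ?thesis
  proof
    fix c ::'k and x :: "'x list \<Rightarrow>\<^sub>0 'k"
    assume "x \<in> carrier (free_algebra V)"
    then show "c \<odot>\<^bsub>free_algebra V\<^esub> x \<in> carrier (free_algebra V)"
      using m_closed[OF sc] by (simp add: free_algebra_simps)
  next
    fix c ::'k and x y :: "'x list \<Rightarrow>\<^sub>0 'k"
    show "x \<otimes>\<^bsub>free_algebra V\<^esub> (c \<odot>\<^bsub>free_algebra V\<^esub> y) =
      c \<odot>\<^bsub>free_algebra V\<^esub> (x \<otimes>\<^bsub>free_algebra V\<^esub> y)"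
      by (simp add: free_algebra_simps scalar_commute flip: mult.assoc)
  qed (simp_all add: free_algebra_simps single_add mult_single plus_list_def distrib_left
      distrib_right scalar_one flip: mult.assoc)
qed

text \<open>A word is sent to the product of the images of its letters, and this rule is extended
  linearly.\<close>

lemma free_algebra_lift:
  fixes B :: "('k::field, 'b) module"
  assumes B: "unital_algebra B" and a: "\<And>v. v \<in> V \<Longrightarrow> a v \<in> carrier B"
  obtains h where "h \<in> algebra_hom (free_algebra V) B" "\<And>v. v \<in> V \<Longrightarrow> h (variable v) = a v"
proof -
  interpret B: unital_algebra B by fact
  \<comment> \<open>Letters outside \<open>V\<close> get the dummy value one, so that
    \<open>m\<close> and \<open>h\<close> land in \<open>carrier B\<close> for every argument and
    the inductions need no condition on the letters.\<close>
  define a' where "a' v = (if v \<in> V then a v else \<one>\<^bsub>B\<^esub>)" for v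
  define m where "m w = foldr (\<lambda>v y. a' v \<otimes>\<^bsub>B\<^esub> y) w \<one>\<^bsub>B\<^esub>" for w
  define h where "h p = (\<Oplus>\<^bsub>B\<^esub>w\<in>Poly_Mapping.keys p. Poly_Mapping.lookup p w \<odot>\<^bsub>B\<^esub> m w)" for p
  have a'[simp]: "a' v \<in> carrier B" for v using a by (simp add: a'_def)
  have m[simp]: "m w \<in> carrier B" for w unfolding m_def by (induction w) auto
  have m_app: "m (u @ w) = m u \<otimes>\<^bsub>B\<^esub> m w" for u w
    by (induction u) (simp_all add: m_def[of "[]"] m_def[of "_ # _"] B.m_assoc flip: m_def)
  \<comment> \<open>The sum may run over any finite set containing the support. Additivity needs
    this, because two elements and their sum have different supports.\<close>
  have h_ext: "h p = (\<Oplus>\<^bsub>B\<^esub>w\<in>K. Poly_Mapping.lookup p w \<odot>\<^bsub>B\<^esub> m w)"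
    if "finite K" "Poly_Mapping.keys p \<subseteq> K" for p K
    unfolding h_def using that
    by (intro B.add.finprod_mono_neutral_cong_left) (auto simp: in_keys_iff)
  have h_cl[simp]: "h p \<in> carrier B" for p
    unfolding h_def by (auto intro: B.finsum_closed)
  have h_add: "h (p + r) = h p \<oplus>\<^bsub>B\<^esub> h r" for p r
  proof -
    let ?K = "Poly_Mapping.keys p \<union> Poly_Mapping.keys r"
    have "h (p + r) = (\<Oplus>\<^bsub>B\<^esub>w\<in>?K. Poly_Mapping.lookup p w \<odot>\<^bsub>B\<^esub> m w \<oplus>\<^bsub>B\<^esub> Poly_Mapping.lookup r w \<odot>\<^bsub>B\<^esub> m w)"
      by (subst h_ext[of ?K])
        (use Poly_Mapping.keys_add[of p r] in \<open>auto simp: lookup_add B.smult_l_distr\<close>)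
    also have "\<dots> = h p \<oplus>\<^bsub>B\<^esub> h r"
      by (subst B.finsum_addf) (auto simp flip: h_ext)
    finally show ?thesis .
  qed
  have h_single: "h (Poly_Mapping.single w c) = c \<odot>\<^bsub>B\<^esub> m w" for w c
    by (subst h_ext[of "{w}"]) auto
  have upd: "Poly_Mapping.update w c p = Poly_Mapping.single w c + p"
    if "w \<notin> Poly_Mapping.keys p" for w and c :: 'k and p :: "'a list \<Rightarrow>\<^sub>0 'k"
    by (rule poly_mapping_eqI)
      (use that in \<open>auto simp: lookup_update lookup_add lookup_single in_keys_iff when_def\<close>)
  have h_0: "h 0 = \<zero>\<^bsub>B\<^esub>" by (simp add: h_def)
  \<comment> \<open>Multiplicativity is proved first for a monomial on the left, by induction on the
    right factor, and then for a general left factor.\<close>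
  have h_mult_single: "h (Poly_Mapping.single w c * r) = (c \<odot>\<^bsub>B\<^esub> m w) \<otimes>\<^bsub>B\<^esub> h r" for w c r
    by (induction r rule: update_induct)
      (simp_all add: h_0 upd distrib_left h_add mult_single h_single plus_list_def m_app B.r_distr B.smult_r_distr mult.commute)
  have h_mult: "h (p * r) = h p \<otimes>\<^bsub>B\<^esub> h r" for p r
    by (induction p rule: update_induct)
      (simp_all add: h_0 upd distrib_right h_add h_mult_single h_single B.l_distr)
  have m1: "m [] = \<one>\<^bsub>B\<^esub>" by (simp add: m_def)
  have "h \<in> algebra_hom (free_algebra V) B"
    by (rule algebra_homI)
      (simp_all add: free_algebra_simps h_add h_mult h_single m1 flip: scalar_one)
  moreover have "h (variable v) = a v" if "v \<in> V" for v
    using that a by (simp add: h_single m_def a'_def)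
  ultimately show thesis using that by blast
qed

section \<open>Quantum Borel relations\<close>

text \<open>
  The relations of \<open>O\<^sub>q(B\<^sup>\<plusminus>)\<close>; the predicate \<open>Z\<close> marks the entries that vanish. For triangular
  matrices the quantum determinant relation only concerns the diagonal.
\<close>

locale quantum_borel = unital_algebra A for A :: "('k::field, 'a) module" (structure) +
  fixes n :: nat and q :: 'k and Z :: "nat \<Rightarrow> nat \<Rightarrow> bool" and x :: "nat \<Rightarrow> nat \<Rightarrow> 'a"
  assumes closed [simp]: "i \<in> {1..n+1} \<Longrightarrow> j \<in> {1..n+1} \<Longrightarrow> x i j \<in> carrier A"
    and row: "i \<in> {1..n+1} \<Longrightarrow> j \<in> {1..n+1} \<Longrightarrow> m \<in> {1..n+1} \<Longrightarrow> j < m \<Longrightarrow>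
      x i j \<otimes> x i m = q \<odot> (x i m \<otimes> x i j)"
    and col: "i \<in> {1..n+1} \<Longrightarrow> j \<in> {1..n+1} \<Longrightarrow> l \<in> {1..n+1} \<Longrightarrow> i < l \<Longrightarrow>
      x i j \<otimes> x l j = q \<odot> (x l j \<otimes> x i j)"
    and anti: "i \<in> {1..n+1} \<Longrightarrow> j \<in> {1..n+1} \<Longrightarrow> l \<in> {1..n+1} \<Longrightarrow> m \<in> {1..n+1} \<Longrightarrow>
      i < l \<Longrightarrow> m < j \<Longrightarrow> x i j \<otimes> x l m = x l m \<otimes> x i j"
    and cross: "i \<in> {1..n+1} \<Longrightarrow> j \<in> {1..n+1} \<Longrightarrow> l \<in> {1..n+1} \<Longrightarrow> m \<in> {1..n+1} \<Longrightarrow>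
      i < l \<Longrightarrow> j < m \<Longrightarrow>
      x i j \<otimes> x l m = x l m \<otimes> x i j \<oplus> (q - inverse q) \<odot> (x i m \<otimes> x l j)"
    and vanish: "i \<in> {1..n+1} \<Longrightarrow> j \<in> {1..n+1} \<Longrightarrow> Z i j \<Longrightarrow> x i j = \<zero>"
    and diag: "foldr (\<lambda>i y. x i i \<otimes> y) [1..<n+2] \<one> = \<one>"

lemma perm_length_id: "perm_length m id = 0"
  unfolding perm_length_def by (rule Least_eq_0) (auto intro: exI[of _ "[]"])

lemma X_carrier:
  "i \<in> {1..n+1} \<Longrightarrow> j \<in> {1..n+1} \<Longrightarrow> (X i j :: 'k::field fa) \<in> carrier (matrix_free_algebra n)"
  by (simp add: free_algebra_def)

lemma free_algebra_closed:
  fixes p r :: "'x list \<Rightarrow>\<^sub>0 'k::field"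
  shows "p \<in> carrier (free_algebra V) \<Longrightarrow> r \<in> carrier (free_algebra V) \<Longrightarrow>
      p * r \<in> carrier (free_algebra V)"
    and "p \<in> carrier (free_algebra V) \<Longrightarrow> r \<in> carrier (free_algebra V) \<Longrightarrow>
      p + r \<in> carrier (free_algebra V)"
    and "p \<in> carrier (free_algebra V) \<Longrightarrow> scalar c * p \<in> carrier (free_algebra V)"
    and "p \<in> carrier (free_algebra V) \<Longrightarrow> r \<in> carrier (free_algebra V) \<Longrightarrow>
      p - r \<in> carrier (free_algebra V)"
    and "(1 :: 'x list \<Rightarrow>\<^sub>0 'k) \<in> carrier (free_algebra V)"
    and "(0 :: 'x list \<Rightarrow>\<^sub>0 'k) \<in> carrier (free_algebra V)"
proof -
  show "p \<in> carrier (free_algebra V) \<Longrightarrow> r \<in> carrier (free_algebra V) \<Longrightarrow>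
      p - r \<in> carrier (free_algebra V)"
    using Poly_Mapping.keys_diff[of p r] unfolding free_algebra_def by fastforce
qed (use unital_algebra.smult_closed[OF unital_algebra_free_algebra, of p V c]
    ring.ring_simprules(1,5)[OF ring_free_algebra, of p V r]
    ring.ring_simprules(2,6)[OF ring_free_algebra, of V]
  in \<open>simp_all add: free_algebra_simps\<close>)

section \<open>Evaluating the defining relators under a homomorphism\<close>

context
  fixes n :: nat and B :: "('k::field, 'b) module" and h :: "'k fa \<Rightarrow> 'b"
  assumes B: "unital_algebra B" and h: "h \<in> algebra_hom (matrix_free_algebra n) B"
begin

interpretation B: unital_algebra B by (rule B)
interpretation F: unital_algebra "matrix_free_algebra n :: ('k, 'k fa) module"
  by (rule unital_algebra_free_algebra)
interpretation h: ring_hom_ring "matrix_free_algebra n" B h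
  by (rule algebra_hom_ring_hom_ring[OF F.unital_algebra_axioms B h])

abbreviation "FC \<equiv> carrier (matrix_free_algebra n :: ('k, 'k fa) module)"

lemma hom_F:
  fixes p r :: "'k fa"
  shows "p \<in> FC \<Longrightarrow> r \<in> FC \<Longrightarrow> h (p * r) = h p \<otimes>\<^bsub>B\<^esub> h r"
    and "p \<in> FC \<Longrightarrow> r \<in> FC \<Longrightarrow> h (p + r) = h p \<oplus>\<^bsub>B\<^esub> h r"
    and "p \<in> FC \<Longrightarrow> h (scalar c * p) = c \<odot>\<^bsub>B\<^esub> h p"
    and "h 1 = \<one>\<^bsub>B\<^esub>" "h 0 = \<zero>\<^bsub>B\<^esub>"
  using algebra_homD[OF h] h.hom_zero by (simp_all add: free_algebra_simps)

text \<open>Relators are written as differences; this turns their vanishing into the corresponding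
  equation in \<open>B\<close>.\<close>

lemma hom_diff_eq_zero:
  assumes "p \<in> FC" "r \<in> FC"
  shows "h (p - r) = \<zero>\<^bsub>B\<^esub> \<longleftrightarrow> h p = h r"
proof -
  have "h p = h (p - r) \<oplus>\<^bsub>B\<^esub> h r"
    using hom_F(2)[OF free_algebra_closed(4)[OF assms] assms(2)] by simp
  moreover have "h (p - r) \<in> carrier B" "h r \<in> carrier B"
    using free_algebra_closed(4)[OF assms] assms(2) h.hom_closed by blast+
  ultimately show ?thesis
    by (metis B.add.right_cancel B.l_zero B.zero_closed)
qed

lemma hom_prod_list:
  assumes "\<And>i. i \<in> set xs \<Longrightarrow> f i \<in> FC"
  shows "(\<Prod>i\<leftarrow>xs. f i) \<in> FC"
    and "h (\<Prod>i\<leftarrow>xs. f i) = foldr (\<lambda>i y. h (f i) \<otimes>\<^bsub>B\<^esub> y) xs \<one>\<^bsub>B\<^esub>"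
  using assms by (induction xs) (simp_all add: free_algebra_closed hom_F del: One_nat_def)

lemma foldr_mult_zero:
  assumes "\<And>i. i \<in> set xs \<Longrightarrow> y i \<in> carrier B" "i \<in> set xs" "y i = \<zero>\<^bsub>B\<^esub>"
  shows "foldr (\<lambda>i z. y i \<otimes>\<^bsub>B\<^esub> z) xs \<one>\<^bsub>B\<^esub> = \<zero>\<^bsub>B\<^esub>"
proof -
  have "foldr (\<lambda>i z. y i \<otimes>\<^bsub>B\<^esub> z) us \<one>\<^bsub>B\<^esub> \<in> carrier B" if "set us \<subseteq> set xs" for us
    using that assms(1) by (induction us) auto
  then show ?thesis
    using assms by (induction xs) (auto simp: subset_iff)
qed

lemma hom_sum_zero:
  assumes "\<And>s. s \<in> S \<Longrightarrow> f s \<in> FC" "\<And>s. s \<in> S \<Longrightarrow> h (f s) = \<zero>\<^bsub>B\<^esub>"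
  shows "sum f S \<in> FC \<and> h (sum f S) = \<zero>\<^bsub>B\<^esub>"
  using assms by (induction S rule: infinite_finite_induct) (simp_all add: free_algebra_closed hom_F del: One_nat_def)

text \<open>Only the identity permutation contributes to the determinant of a triangular matrix.\<close>

lemma hom_quantum_det:
  fixes q :: 'k
  assumes Z: "Z = (\<lambda>i j. i < j) \<or> Z = (\<lambda>i j. j < i)"
    and vanish: "\<And>i j. i \<in> {1..n+1} \<Longrightarrow> j \<in> {1..n+1} \<Longrightarrow> Z i j \<Longrightarrow> h (X i j) = \<zero>\<^bsub>B\<^esub>"
  shows "quantum_det n q \<in> FC \<and>
    h (quantum_det n q) = foldr (\<lambda>i y. h (X i i) \<otimes>\<^bsub>B\<^esub> y) [1..<n+2] \<one>\<^bsub>B\<^esub>"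
proof -
  let ?S = "{\<sigma>. \<sigma> permutes {1..n+1}}"
  let ?f = "\<lambda>\<sigma>. scalar ((- q) ^ perm_length (n+1) \<sigma>) * (\<Prod>i\<leftarrow>[1..<n+2]. X i (\<sigma> i))"
  have X: "X i (\<sigma> i) \<in> FC" if "\<sigma> permutes {1..n+1}" "i \<in> set [1..<n+2]" for \<sigma> i
    using that permutes_in_image[OF that(1), of i] by (intro X_carrier) auto
  have f_cl: "?f \<sigma> \<in> FC" if "\<sigma> \<in> ?S" for \<sigma>
    using that by (intro free_algebra_closed(3) hom_prod_list X) auto
  have "h (?f \<sigma>) = \<zero>\<^bsub>B\<^esub>" if \<sigma>: "\<sigma> permutes {1..n+1}" "\<sigma> \<noteq> id" for \<sigma>
  proof -
    \<comment> \<open>A permutation of an interval that moves no point up, or no point down, is the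
      identity. Any other permutation therefore picks an entry in the vanishing triangle, whichever
      triangle that is.\<close>
    have "\<exists>i\<in>{1..n+1}. Z i (\<sigma> i)"
      using Z permutes_natset_le[OF \<sigma>(1)] permutes_natset_ge[OF \<sigma>(1)] \<sigma>(2)
      by (meson linorder_not_less)
    then obtain i where i: "i \<in> {1..n+1}" "Z i (\<sigma> i)" by blast
    then have "h (X i (\<sigma> i)) = \<zero>\<^bsub>B\<^esub>"
      using permutes_in_image[OF \<sigma>(1)] by (intro vanish) auto
    then have "foldr (\<lambda>i y. h (X i (\<sigma> i)) \<otimes>\<^bsub>B\<^esub> y) [1..<n+2] \<one>\<^bsub>B\<^esub> = \<zero>\<^bsub>B\<^esub>"
      using i X[OF \<sigma>(1)] h.hom_closed by (intro foldr_mult_zero) auto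
    then show ?thesis
      using hom_prod_list[of "[1..<n+2]" "\<lambda>i. X i (\<sigma> i)"] X[OF \<sigma>(1)]
      by (simp only: hom_F(3) B.smult_zero_right)
  qed
  then have rest: "sum ?f (?S - {id}) \<in> FC \<and> h (sum ?f (?S - {id})) = \<zero>\<^bsub>B\<^esub>"
    using f_cl by (intro hom_sum_zero) auto
  have "quantum_det n q = ?f id + sum ?f (?S - {id})"
    unfolding quantum_det_def
    by (rule sum.remove) (auto simp: finite_permutations permutes_id)
  moreover have "?f id = (\<Prod>i\<leftarrow>[1..<n+2]. X i i)"
    by (simp add: perm_length_id scalar_one del: upt_Suc)
  ultimately have qd: "quantum_det n q = (\<Prod>i\<leftarrow>[1..<n+2]. X i i) + sum ?f (?S - {id})"
    by (simp only:)
  have D: "(\<Prod>i\<leftarrow>[1..<n+2]. X i i) \<in> FC"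
    "h (\<Prod>i\<leftarrow>[1..<n+2]. X i i) = foldr (\<lambda>i y. h (X i i) \<otimes>\<^bsub>B\<^esub> y) [1..<n+2] \<one>\<^bsub>B\<^esub>"
    by (intro hom_prod_list X_carrier; auto simp del: upt_Suc)+
  have "h (quantum_det n q) = h (\<Prod>i\<leftarrow>[1..<n+2]. X i i) \<oplus>\<^bsub>B\<^esub> \<zero>\<^bsub>B\<^esub>"
    unfolding qd using rest D(1) by (simp only: hom_F(2))
  also have "\<dots> = h (\<Prod>i\<leftarrow>[1..<n+2]. X i i)"
    by (rule B.r_zero[OF h.hom_closed[OF D(1)]])
  finally have "h (quantum_det n q) = foldr (\<lambda>i y. h (X i i) \<otimes>\<^bsub>B\<^esub> y) [1..<n+2] \<one>\<^bsub>B\<^esub>"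
    using D(2) by (simp only:)
  moreover have "quantum_det n q \<in> FC"
    unfolding qd using D(1) rest by (intro free_algebra_closed(2)) blast+
  ultimately show ?thesis by blast
qed

text \<open>The dictionary between relators and relations. Read forwards it shows that the Borel
  quotients satisfy the relations, read backwards it produces homomorphisms out of them. The
  vanishing of one triangle is part of the equivalence because the determinant reduces to its
  diagonal term only under this condition.\<close>

lemma hom_relators_zero_iff:
  fixes q :: 'k
  assumes Z: "Z = (\<lambda>i j. i < j) \<or> Z = (\<lambda>i j. j < i)"
  shows "(\<forall>r\<in>SL_relators n q. h r = \<zero>\<^bsub>B\<^esub>) \<and>
      (\<forall>i\<in>{1..n+1}. \<forall>j\<in>{1..n+1}. Z i j \<longrightarrow> h (X i j) = \<zero>\<^bsub>B\<^esub>) \<longleftrightarrow>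
    quantum_borel B n q Z (\<lambda>i j. h (X i j))" (is "?L \<longleftrightarrow> ?R")
proof -
  have two: "h (X i j * X l m - scalar c * X i' j' * X l' m') = \<zero>\<^bsub>B\<^esub> \<longleftrightarrow>
      h (X i j) \<otimes>\<^bsub>B\<^esub> h (X l m) = c \<odot>\<^bsub>B\<^esub> (h (X i' j') \<otimes>\<^bsub>B\<^esub> h (X l' m'))"
    if "i \<in> {1..n+1}" "j \<in> {1..n+1}" "l \<in> {1..n+1}" "m \<in> {1..n+1}"
      "i' \<in> {1..n+1}" "j' \<in> {1..n+1}" "l' \<in> {1..n+1}" "m' \<in> {1..n+1}" for c i j l m i' j' l' m'
    using that by (subst hom_diff_eq_zero) (simp_all add: free_algebra_closed hom_F X_carrier mult.assoc del: One_nat_def atLeastAtMost_iff)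
  have comm: "h (X i j * X l m - X l m * X i j) = \<zero>\<^bsub>B\<^esub> \<longleftrightarrow>
      h (X i j) \<otimes>\<^bsub>B\<^esub> h (X l m) = h (X l m) \<otimes>\<^bsub>B\<^esub> h (X i j)"
    if "i \<in> {1..n+1}" "j \<in> {1..n+1}" "l \<in> {1..n+1}" "m \<in> {1..n+1}" for i j l m
    using that by (subst hom_diff_eq_zero) (simp_all add: free_algebra_closed hom_F X_carrier del: One_nat_def atLeastAtMost_iff)
  have four: "h (X i j * X l m - X l m * X i j - scalar c * X i m * X l j) = \<zero>\<^bsub>B\<^esub> \<longleftrightarrow>
      h (X i j) \<otimes>\<^bsub>B\<^esub> h (X l m) =
        h (X l m) \<otimes>\<^bsub>B\<^esub> h (X i j) \<oplus>\<^bsub>B\<^esub> c \<odot>\<^bsub>B\<^esub> (h (X i m) \<otimes>\<^bsub>B\<^esub> h (X l j))"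
    if "i \<in> {1..n+1}" "j \<in> {1..n+1}" "l \<in> {1..n+1}" "m \<in> {1..n+1}" for c i j l m
  proof -
    \<comment> \<open>The two subtractions are merged into a single difference so that
      \<open>hom_diff_eq_zero\<close> applies.\<close>
    have "X i j * X l m - X l m * X i j - scalar c * X i m * X l j =
      X i j * X l m - (X l m * X i j + scalar c * (X i m * X l j))"
      by (simp add: mult.assoc)
    then show ?thesis
      using that by (simp only:) (subst hom_diff_eq_zero, simp_all add: free_algebra_closed hom_F X_carrier del: One_nat_def atLeastAtMost_iff)
  qed
  have det: "h (quantum_det n q - 1) = \<zero>\<^bsub>B\<^esub> \<longleftrightarrow>
      foldr (\<lambda>i y. h (X i i) \<otimes>\<^bsub>B\<^esub> y) [1..<n+2] \<one>\<^bsub>B\<^esub> = \<one>\<^bsub>B\<^esub>"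
    if "\<forall>i\<in>{1..n+1}. \<forall>j\<in>{1..n+1}. Z i j \<longrightarrow> h (X i j) = \<zero>\<^bsub>B\<^esub>"
    using hom_quantum_det[OF Z, of q] that
    by (subst hom_diff_eq_zero) (simp_all add: free_algebra_closed hom_F del: upt_Suc One_nat_def)
  show ?thesis
  proof
    assume L: ?L
    note r = L[THEN conjunct1, rule_format]
    show ?R
    proof (unfold_locales, goal_cases)
      case (2 i j m)
      then have "h (X i j * X i m - scalar q * X i m * X i j) = \<zero>\<^bsub>B\<^esub>"
        by (intro r) (unfold SL_relators_def, blast)
      then show ?case using 2 by (simp add: two)
    next
      case (3 i j l)
      then have "h (X i j * X l j - scalar q * X l j * X i j) = \<zero>\<^bsub>B\<^esub>"
        by (intro r) (unfold SL_relators_def, blast)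
      then show ?case using 3 by (simp add: two)
    next
      case (4 i j l m)
      then have "h (X i j * X l m - X l m * X i j) = \<zero>\<^bsub>B\<^esub>"
        by (intro r) (unfold SL_relators_def, blast)
      then show ?case using 4 by (simp add: comm)
    next
      case (5 i j l m)
      then have "h (X i j * X l m - X l m * X i j - scalar (q - inverse q) * X i m * X l j) = \<zero>\<^bsub>B\<^esub>"
        by (intro r) (unfold SL_relators_def, blast)
      then show ?case using 5 by (simp add: four)
    next
      case 7
      have "h (quantum_det n q - 1) = \<zero>\<^bsub>B\<^esub>"
        by (intro r) (simp add: SL_relators_def)
      then show ?case using L det by blast
    next
      case (1 i j)
      then show ?case by (intro h.hom_closed X_carrier)
    next
      case (6 i j)
      then show ?case using L by blast
    qed
  next
    assume ?R
    then interpret R: quantum_borel B n q Z "\<lambda>i j. h (X i j)" .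
    have v: "\<forall>i\<in>{1..n+1}. \<forall>j\<in>{1..n+1}. Z i j \<longrightarrow> h (X i j) = \<zero>\<^bsub>B\<^esub>"
      using R.vanish by blast
    have "h r = \<zero>\<^bsub>B\<^esub>" if "r \<in> SL_relators n q" for r
      using that unfolding SL_relators_def
      apply (elim UnE CollectE exE conjE singletonE)
          apply (simp only: two R.row)
         apply (simp only: two R.col)
        apply (simp only: comm, rule R.anti, assumption+)
       apply (simp only: four, rule R.cross, assumption+)
      apply (simp only: det[OF v] R.diag)
      done
    then show ?L using v by blast
  qed
qed

end

section \<open>Presentation and universal property of the quantum Borel algebras\<close>

definition borel_ideal :: "(nat \<Rightarrow> nat \<Rightarrow> bool) \<Rightarrow> nat \<Rightarrow> 'k::field \<Rightarrow> 'k fa set set" where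
  "borel_ideal Z n q =
    genideal (Oq_SL n q) {X_SL n q i j | i j. i \<in> {1..n+1} \<and> j \<in> {1..n+1} \<and> Z i j}"

text \<open>Treats both Borel algebras at once: killing the entries with \<open>j < i\<close> gives
  \<open>Oq_Bplus\<close>, killing those with \<open>i < j\<close> gives
  \<open>Oq_Bminus\<close>.\<close>

definition Oq_borel :: "(nat \<Rightarrow> nat \<Rightarrow> bool) \<Rightarrow> nat \<Rightarrow> 'k::field \<Rightarrow> ('k, 'k fa set set) module" where
  "Oq_borel Z n q = quotient_algebra (Oq_SL n q) (borel_ideal Z n q)"

definition X_borel ::
  "(nat \<Rightarrow> nat \<Rightarrow> bool) \<Rightarrow> nat \<Rightarrow> 'k::field \<Rightarrow> nat \<Rightarrow> nat \<Rightarrow> 'k fa set set" where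
  "X_borel Z n q i j = borel_ideal Z n q +>\<^bsub>Oq_SL n q\<^esub> X_SL n q i j"

lemma unital_algebra_Oq_SL: "unital_algebra (Oq_SL n q)"
  unfolding Oq_SL_def
  by (rule unital_algebra.unital_algebra_quotient[OF unital_algebra_free_algebra ideal_SL_ideal])

lemma borel_gens_closed:
  "{X_SL n q i j | i j. i \<in> {1..n+1} \<and> j \<in> {1..n+1} \<and> Z i j} \<subseteq> carrier (Oq_SL n q)"
  using X_SL_carrier by blast

lemma ideal_borel_ideal: "ideal (borel_ideal Z n q) (Oq_SL n q)"
  unfolding borel_ideal_def by (rule ring.genideal_ideal[OF ring_Oq_SL borel_gens_closed])

lemma unital_algebra_Oq_borel: "unital_algebra (Oq_borel Z n q)"
  unfolding Oq_borel_def
  by (rule unital_algebra.unital_algebra_quotient[OF unital_algebra_Oq_SL ideal_borel_ideal])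

text \<open>The composite of the two quotient maps kills the relators of \<open>Oq_SL\<close> and
  the entries marked by \<open>Z\<close>, so the dictionary applies to it.\<close>

lemma quantum_borel_Oq_borel:
  fixes q :: "'k::field"
  assumes Z: "Z = (\<lambda>i j. i < j) \<or> Z = (\<lambda>i j. j < i)"
  shows "quantum_borel (Oq_borel Z n q) n q Z (X_borel Z n q)"
proof -
  interpret F: unital_algebra "matrix_free_algebra n :: ('k, 'k fa) module"
    by (rule unital_algebra_free_algebra)
  interpret S: unital_algebra "Oq_SL n q" by (rule unital_algebra_Oq_SL)
  interpret B: unital_algebra "Oq_borel Z n q" by (rule unital_algebra_Oq_borel)
  define f where "f = (\<lambda>p. SL_ideal n q +>\<^bsub>matrix_free_algebra n\<^esub> p)"
  define g where "g = (\<lambda>p. borel_ideal Z n q +>\<^bsub>Oq_SL n q\<^esub> p)"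
  have f: "f \<in> algebra_hom (matrix_free_algebra n) (Oq_SL n q)"
    using F.quotient_map_hom[OF ideal_SL_ideal] by (simp add: f_def Oq_SL_def)
  have g: "g \<in> algebra_hom (Oq_SL n q) (Oq_borel Z n q)"
    using S.quotient_map_hom[OF ideal_borel_ideal] by (simp add: g_def Oq_borel_def)
  interpret g: ring_hom_ring "Oq_SL n q" "Oq_borel Z n q" g
    by (rule algebra_hom_ring_hom_ring[OF S.unital_algebra_axioms B.unital_algebra_axioms g])
  have gf: "(g \<circ> f) (X i j) = X_borel Z n q i j" for i j
    by (simp add: g_def f_def X_borel_def X_SL_def)
  have "(g \<circ> f) r = \<zero>\<^bsub>Oq_borel Z n q\<^esub>" if "r \<in> SL_relators n q" for r
  proof -
    have "r \<in> SL_ideal n q"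
      using that F.genideal_self[OF SL_relators_carrier] by (auto simp: SL_ideal_def)
    then have "f r = \<zero>\<^bsub>Oq_SL n q\<^esub>"
      using F.quotient_map_zero[OF ideal_SL_ideal] by (simp add: f_def Oq_SL_def)
    then show ?thesis by simp
  qed
  moreover have "(g \<circ> f) (X i j) = \<zero>\<^bsub>Oq_borel Z n q\<^esub>"
    if "i \<in> {1..n+1}" "j \<in> {1..n+1}" "Z i j" for i j
  proof -
    have "X_SL n q i j \<in> borel_ideal Z n q"
      using that S.genideal_self[OF borel_gens_closed] unfolding borel_ideal_def by blast
    then show ?thesis
      using S.quotient_map_zero[OF ideal_borel_ideal] unfolding gf X_borel_def Oq_borel_def by blast
  qed
  ultimately show ?thesis
    using hom_relators_zero_iff[OF B.unital_algebra_axioms algebra_hom_comp[OF f g] Z, of q]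
    unfolding gf by blast
qed

text \<open>Universal property: the assignment extends to the free algebra, then descends through
  the two quotients in turn. All homomorphisms between Borel algebras below are built from their
  values on the entries in this way.\<close>

lemma Oq_borel_lift:
  fixes q :: "'k::field"
  assumes Z: "Z = (\<lambda>i j. i < j) \<or> Z = (\<lambda>i j. j < i)"
    and a: "quantum_borel B n q Z a"
  obtains h where "h \<in> algebra_hom (Oq_borel Z n q) B"
    "\<And>i j. i \<in> {1..n+1} \<Longrightarrow> j \<in> {1..n+1} \<Longrightarrow> h (X_borel Z n q i j) = a i j"
proof -
  interpret F: unital_algebra "matrix_free_algebra n :: ('k, 'k fa) module"
    by (rule unital_algebra_free_algebra)
  interpret S: unital_algebra "Oq_SL n q" by (rule unital_algebra_Oq_SL)
  interpret a: quantum_borel B n q Z a by (rule a)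
  obtain e where e: "e \<in> algebra_hom (matrix_free_algebra n) B"
    and eX: "\<And>v. v \<in> {1..n+1} \<times> {1..n+1} \<Longrightarrow> e (variable v) = (case v of (i, j) \<Rightarrow> a i j)"
    by (rule free_algebra_lift[OF a.unital_algebra_axioms,
        where V = "{1..n+1} \<times> {1..n+1}" and a = "\<lambda>(i, j). a i j"])
      (use a.closed in \<open>auto simp del: One_nat_def\<close>)
  have eX': "e (X i j) = a i j" if "i \<in> {1..n+1}" "j \<in> {1..n+1}" for i j
    using eX[of "(i, j)"] that by simp
  have "quantum_borel B n q Z (\<lambda>i j. e (X i j))"
  proof (unfold_locales, goal_cases)
    case 7
    have "foldr (\<lambda>i y. e (X i i) \<otimes>\<^bsub>B\<^esub> y) [1..<n+2] \<one>\<^bsub>B\<^esub> = foldr (\<lambda>i y. a i i \<otimes>\<^bsub>B\<^esub> y) [1..<n+2] \<one>\<^bsub>B\<^esub>"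
      by (intro foldr_cong) (auto simp: eX' simp del: One_nat_def)
    then show ?case using a.diag by simp
  next
    case (4 i j l m)
    then show ?case by (simp only: eX') (rule a.anti)
  qed (simp_all only: eX' a.closed a.row a.col a.vanish a.cross)
  then have zero: "\<And>r. r \<in> SL_relators n q \<Longrightarrow> e r = \<zero>\<^bsub>B\<^esub>"
    using hom_relators_zero_iff[OF a.unital_algebra_axioms e Z, of q] by blast
  obtain f where f: "f \<in> algebra_hom (Oq_SL n q) B"
    and fX: "\<And>p. p \<in> carrier (matrix_free_algebra n) \<Longrightarrow>
      f (SL_ideal n q +>\<^bsub>matrix_free_algebra n\<^esub> p) = e p"
    using F.quotient_genideal_lift[OF SL_relators_carrier a.unital_algebra_axioms e zero]
    unfolding Oq_SL_def SL_ideal_def by blast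
  have fX': "f (X_SL n q i j) = a i j" if "i \<in> {1..n+1}" "j \<in> {1..n+1}" for i j
    using that by (simp add: X_SL_def fX X_carrier eX' del: One_nat_def)
  obtain g where g: "g \<in> algebra_hom (Oq_borel Z n q) B"
    and gX: "\<And>p. p \<in> carrier (Oq_SL n q) \<Longrightarrow> g (borel_ideal Z n q +>\<^bsub>Oq_SL n q\<^esub> p) = f p"
    unfolding Oq_borel_def borel_ideal_def
    by (rule S.quotient_genideal_lift[OF borel_gens_closed[of n q Z] a.unital_algebra_axioms f])
      (use fX' a.vanish in force)+
  show thesis
  proof (rule that[OF g])
    fix i j assume "i \<in> {1..n+1}" "j \<in> {1..n+1}"
    then show "g (X_borel Z n q i j) = a i j"
      unfolding X_borel_def by (subst gX[OF X_SL_carrier]) (simp_all only: fX')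
  qed
qed

section \<open>Torus action and twisting\<close>

text \<open>Multiply the given relation by \<open>inv t\<close> on both sides.\<close>

lemma (in unital_algebra) q_commute_inv:
  assumes "y \<in> carrier A" "t \<in> Units A" "c \<noteq> 0" "y \<otimes> t = c \<odot> (t \<otimes> y)"
  shows "y \<otimes> inv t = inverse c \<odot> (inv t \<otimes> y)"
proof -
  have c: "t \<in> carrier A" "inv t \<in> carrier A" using assms(2) by auto
  have "inv t \<otimes> y = inv t \<otimes> (y \<otimes> t) \<otimes> inv t"
    using assms(1,2) c by (simp add: m_assoc)
  also have "\<dots> = c \<odot> (inv t \<otimes> t \<otimes> y \<otimes> inv t)"
    unfolding assms(4) using assms(1) c by (simp add: m_assoc del: Units_l_inv)
  also have "\<dots> = c \<odot> (y \<otimes> inv t)"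
    using assms(1,2) c by simp
  finally have "inverse c \<odot> (inv t \<otimes> y) = inverse c \<odot> (c \<odot> (y \<otimes> inv t))" by simp
  then show ?thesis using assms(1,3) c by simp
qed

section \<open>Invertible factors of a product equal to one\<close>

context monoid
begin

lemma foldr_mult_closed:
  "(\<And>i. i \<in> set xs \<Longrightarrow> f i \<in> carrier G) \<Longrightarrow> foldr (\<lambda>i y. f i \<otimes> y) xs \<one> \<in> carrier G"
  by (induction xs) auto

lemma foldr_mult_append:
  "(\<And>i. i \<in> set (xs @ ys) \<Longrightarrow> f i \<in> carrier G) \<Longrightarrow>
    foldr (\<lambda>i y. f i \<otimes> y) (xs @ ys) \<one> =
      foldr (\<lambda>i y. f i \<otimes> y) xs \<one> \<otimes> foldr (\<lambda>i y. f i \<otimes> y) ys \<one>"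
  using foldr_mult_closed[of _ f] by (induction xs) (simp_all add: m_assoc)

lemma foldr_mult_commute:
  assumes "z \<in> carrier G" "\<And>i. i \<in> set xs \<Longrightarrow> f i \<in> carrier G \<and> f i \<otimes> z = z \<otimes> f i"
  shows "foldr (\<lambda>i y. f i \<otimes> y) xs \<one> \<otimes> z = z \<otimes> foldr (\<lambda>i y. f i \<otimes> y) xs \<one>"
  using assms(2)
proof (induction xs)
  case (Cons i xs)
  let ?P = "foldr (\<lambda>i y. f i \<otimes> y) xs \<one>"
  have c: "?P \<in> carrier G" "f i \<in> carrier G" using Cons.prems by (auto intro: foldr_mult_closed)
  have "f i \<otimes> ?P \<otimes> z = f i \<otimes> (z \<otimes> ?P)"
    using Cons c assms(1) by (simp add: m_assoc)
  also have "\<dots> = (z \<otimes> f i) \<otimes> ?P"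
    using Cons.prems c assms(1) by (simp flip: m_assoc)
  finally show ?case using c assms(1) by (simp add: m_assoc)
qed (use assms(1) in simp)

text \<open>Write the product as \<open>?L \<otimes> (f i \<otimes> ?R)\<close>. As
  \<open>f i\<close> commutes with both outer parts, \<open>?L \<otimes> ?R\<close> is a two-sided
  inverse of it.\<close>

lemma Units_if_commuting_prod_one:
  assumes "i \<in> set xs" and cl: "\<And>j. j \<in> set xs \<Longrightarrow> f j \<in> carrier G"
    and comm: "\<And>j. j \<in> set xs \<Longrightarrow> f j \<otimes> f i = f i \<otimes> f j"
    and one: "foldr (\<lambda>j y. f j \<otimes> y) xs \<one> = \<one>"
  shows "f i \<in> Units G"
proof -
  obtain us vs where xs: "xs = us @ i # vs" using assms(1) by (meson split_list)
  let ?L = "foldr (\<lambda>j y. f j \<otimes> y) us \<one>" and ?R = "foldr (\<lambda>j y. f j \<otimes> y) vs \<one>"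
  have c: "?L \<in> carrier G" "?R \<in> carrier G" "f i \<in> carrier G"
    using cl by (auto simp: xs intro: foldr_mult_closed)
  have p: "?L \<otimes> (f i \<otimes> ?R) = \<one>"
    using one foldr_mult_append[of us "i # vs" f] cl by (simp add: xs)
  have L: "?L \<otimes> f i = f i \<otimes> ?L" and R: "?R \<otimes> f i = f i \<otimes> ?R"
    using cl comm c by (auto simp: xs intro!: foldr_mult_commute)
  have "f i \<otimes> (?L \<otimes> ?R) = \<one>"
    using p c L by (metis m_assoc)
  moreover have "?L \<otimes> ?R \<otimes> f i = \<one>"
    using p c R by (simp add: m_assoc)
  ultimately show ?thesis
    unfolding Units_def using c by blast
qed

end

text \<open>This is \<open>r\<close> to the power
  \<open>(\<epsilon>\<^sub>i, \<epsilon>\<^sub>j)\<close> for orthonormal weights, so powers of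
  \<open>q\<close> given by inner products of weights become products and quotients of these
  factors.\<close>

definition torus_weight :: "'k::field \<Rightarrow> nat \<Rightarrow> nat \<Rightarrow> 'k" where
  "torus_weight r i j = (if i = j then r else 1)"

lemma torus_weight_simps [simp]:
  "r \<noteq> 0 \<Longrightarrow> torus_weight r i j \<noteq> 0"
  "torus_weight r i i = r"
  "torus_weight (inverse r) i j = inverse (torus_weight r i j)"
  by (simp_all add: torus_weight_def)

section \<open>The diagonal torus, transposition and the twist\<close>

context quantum_borel
begin

text \<open>The correction term in the \<open>cross\<close> relation is a multiple of
  \<open>x i j \<otimes> x j i\<close>, and one of two opposite entries is zero in a triangular
  matrix.\<close>

lemma diag_commute:
  assumes Z: "Z = (\<lambda>i j. i < j) \<or> Z = (\<lambda>i j. j < i)"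
    and "i \<in> {1..n+1}" "j \<in> {1..n+1}"
  shows "x i i \<otimes> x j j = x j j \<otimes> x i i"
proof -
  have *: "x i i \<otimes> x j j = x j j \<otimes> x i i"
    if "i < j" and ij: "i \<in> {1..n+1}" "j \<in> {1..n+1}" for i j
  proof -
    have "x i j = \<zero> \<or> x j i = \<zero>"
      using vanish[OF ij] vanish[OF ij(2,1)] \<open>i < j\<close> Z by auto
    then have "x i j \<otimes> x j i = \<zero>" using closed[OF ij] closed[OF ij(2,1)] by auto
    then show ?thesis
      using cross[OF ij(1,1) ij(2,2) that(1,1)] closed[OF ij(1,1)] closed[OF ij(2,2)] by simp
  qed
  show ?thesis
    by (cases i j rule: linorder_cases) (use * assms(2,3) in auto)
qed

lemma diag_Units:
  assumes Z: "Z = (\<lambda>i j. i < j) \<or> Z = (\<lambda>i j. j < i)" and "i \<in> {1..n+1}"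
  shows "x i i \<in> Units A"
  by (rule Units_if_commuting_prod_one[of i "[1..<n+2]" "\<lambda>i. x i i"])
    (use assms(2) diag diag_commute[OF Z] closed in \<open>auto simp del: upt_Suc One_nat_def\<close>)

text \<open>For \<open>a < b\<close> the position of \<open>k\<close> selects the relation:
  \<open>row\<close> or \<open>col\<close> at the ends, where the power of \<open>q\<close> arises,
  \<open>anti\<close> strictly between them, and \<open>cross\<close> outside. In the last case the
  correction term contains an entry below the diagonal and vanishes.\<close>

lemma torus_action:
  assumes Z: "Z = (\<lambda>i j. j < i)" and q: "q \<noteq> 0"
    and a: "a \<in> {1..n+1}" and b: "b \<in> {1..n+1}" and k: "k \<in> {1..n+1}"
  shows "x a b \<otimes> x k k = (torus_weight q k b / torus_weight q k a) \<odot> (x k k \<otimes> x a b)"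
proof -
  note cl = closed[OF a b] closed[OF k k]
  have zero: "x i j = \<zero>" if "j < i" "i \<in> {1..n+1}" "j \<in> {1..n+1}" for i j
    using vanish[OF that(2,3)] that(1) Z by simp
  consider "b < a" | "a = b" | "a < b" "k < a" | "a < b" "k = a" | "a < b" "a < k" "k < b"
    | "a < b" "k = b" | "a < b" "b < k" by linarith
  then show ?thesis
  proof cases
    case 1
    then show ?thesis using zero[OF 1 a b] cl by simp
  next
    case 2
    then show ?thesis using diag_commute[OF _ a k] Z q cl by simp
  next
    case 3
    then show ?thesis
      using cross[OF k k a b] zero[OF _ a k] cl closed[OF k b] by (simp add: torus_weight_def)
  next
    case 4
    then have "x a a \<otimes> x a b = q \<odot> (x a b \<otimes> x a a)"
      by (intro row a b)
    then show ?thesis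
      using 4 q cl by (simp add: torus_weight_def)
  next
    case 5
    then show ?thesis
      using anti[OF a b k k] cl by (simp add: torus_weight_def)
  next
    case 6
    then show ?thesis
      using col[OF a b b] cl by (simp add: torus_weight_def)
  next
    case 7
    then show ?thesis
      using cross[OF a b k k] zero[OF _ k b] cl closed[OF a k] by (simp add: torus_weight_def)
  qed
qed

lemma torus_action_inv:
  assumes Z: "Z = (\<lambda>i j. j < i)" and q: "q \<noteq> 0"
    and a: "a \<in> {1..n+1}" and b: "b \<in> {1..n+1}" and k: "k \<in> {1..n+1}"
  shows "x a b \<otimes> inv (x k k) = (torus_weight q k a / torus_weight q k b) \<odot> (inv (x k k) \<otimes> x a b)"
  using q_commute_inv[OF closed[OF a b] diag_Units[OF _ k] _ torus_action[OF assms]] Z q by simp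

text \<open>Transposition exchanges the row and column relations. In \<open>cross\<close> it
  reverses the factors of the correction term, which commute by \<open>anti\<close>.\<close>

lemma transpose:
  "quantum_borel A n q (\<lambda>i j. Z j i) (\<lambda>i j. x j i)"
proof (unfold_locales, goal_cases)
  case (4 i j l m)
  then show ?case by (intro anti[symmetric])
next
  case (5 i j l m)
  then show ?case using cross[of j i m l] anti[of j l m i] by simp
qed (use closed row col vanish diag in \<open>auto simp del: upt_Suc One_nat_def\<close>)

text \<open>
  With \<open>T\<close>, \<open>U\<close> mutually inverse torus elements acting by weights, the entries of weight
  \<open>v = \<epsilon>\<^sub>i - \<epsilon>\<^sub>j\<close> are multiplied by \<open>r\<close> to the power \<open>-(v,v)/2\<close> times \<open>T\<^sub>i U\<^sub>j\<close>. The cocycle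
  \<open>r\<close> to the power \<open>-(v,w)\<close> arising from products is the coboundary of the chosen scalars.
\<close>

definition twist :: "'k \<Rightarrow> (nat \<Rightarrow> 'a) \<Rightarrow> (nat \<Rightarrow> 'a) \<Rightarrow> nat \<Rightarrow> nat \<Rightarrow> 'a" where
  "twist r T U i j = (torus_weight r i j / r) \<odot> (T i \<otimes> U j \<otimes> x i j)"

text \<open>All terms of a quadratic relation involve the same two rows and the same two columns. A
  product of twisted entries is the original product times a factor symmetric in the rows and in the
  columns, so the whole relation is multiplied by one common factor. The diagonal is fixed, hence so
  is the determinant relation.\<close>

lemma quantum_borel_twist:
  assumes r: "r \<noteq> 0"
    and cl: "\<And>k. k \<in> {1..n+1} \<Longrightarrow> T k \<in> carrier A" "\<And>k. k \<in> {1..n+1} \<Longrightarrow> U k \<in> carrier A"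
    and TU1: "\<And>k. k \<in> {1..n+1} \<Longrightarrow> T k \<otimes> U k = \<one>"
    and TT: "\<And>k l. k \<in> {1..n+1} \<Longrightarrow> l \<in> {1..n+1} \<Longrightarrow> T k \<otimes> T l = T l \<otimes> T k"
    and UU: "\<And>k l. k \<in> {1..n+1} \<Longrightarrow> l \<in> {1..n+1} \<Longrightarrow> U k \<otimes> U l = U l \<otimes> U k"
    and UT: "\<And>k l. k \<in> {1..n+1} \<Longrightarrow> l \<in> {1..n+1} \<Longrightarrow> U k \<otimes> T l = T l \<otimes> U k"
    and xT: "\<And>a b k. a \<in> {1..n+1} \<Longrightarrow> b \<in> {1..n+1} \<Longrightarrow> k \<in> {1..n+1} \<Longrightarrow>
      x a b \<otimes> T k = (torus_weight r k b / torus_weight r k a) \<odot> (T k \<otimes> x a b)"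
    and xU: "\<And>a b k. a \<in> {1..n+1} \<Longrightarrow> b \<in> {1..n+1} \<Longrightarrow> k \<in> {1..n+1} \<Longrightarrow>
      x a b \<otimes> U k = (torus_weight r k a / torus_weight r k b) \<odot> (U k \<otimes> x a b)"
  shows "quantum_borel A n q Z (twist r T U)"
    and "\<And>i. i \<in> {1..n+1} \<Longrightarrow> twist r T U i i = x i i"
proof -
  \<comment> \<open>With \<open>v = \<epsilon>\<^sub>i - \<epsilon>\<^sub>j\<close> and
    \<open>w = \<epsilon>\<^sub>l - \<epsilon>\<^sub>m\<close>, \<open>D i l j m\<close> is
    \<open>r\<close> to the power \<open>-(v+w, v+w)/2\<close> and \<open>S i l j m\<close> is the
    torus element of weight \<open>v+w\<close>. Both depend only on the total weight, which explains
    their symmetry.\<close>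
  define D where "D i l j m = torus_weight r i j * torus_weight r l m * torus_weight r i m *
    torus_weight r l j / (r * r * torus_weight r i l * torus_weight r j m)" for i l j m
  define S where "S i l j m = (T i \<otimes> T l) \<otimes> (U j \<otimes> U m)" for i l j m
  have sym: "torus_weight r i j = torus_weight r j i" for i j
    by (simp add: torus_weight_def)
  have D_sym: "D l i j m = D i l j m" "D i l m j = D i l j m" for i l j m
    by (simp_all add: D_def sym[of i l] sym[of j m] mult_ac)
  have S_cl: "S i l j m \<in> carrier A" if "i \<in> {1..n+1}" "l \<in> {1..n+1}" "j \<in> {1..n+1}" "m \<in> {1..n+1}"
    for i l j m using that cl by (simp add: S_def del: atLeastAtMost_iff)
  have S_sym: "S l i j m = S i l j m" "S i l m j = S i l j m"
    if "i \<in> {1..n+1}" "l \<in> {1..n+1}" "j \<in> {1..n+1}" "m \<in> {1..n+1}" for i l j m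
    using TT[OF that(1,2)] UU[OF that(3,4)] by (simp_all add: S_def)
  \<comment> \<open>Moving \<open>T l\<close> and \<open>U m\<close> to the left past
    \<open>x i j\<close> costs \<open>r\<close> to the power \<open>-(v,w)\<close>. Together with
    the scalars of the two twisted entries this is exactly \<open>D i l j m\<close>.\<close>
  have prod: "twist r T U i j \<otimes> twist r T U l m = D i l j m \<odot> (S i l j m \<otimes> (x i j \<otimes> x l m))"
    if I: "i \<in> {1..n+1}" "l \<in> {1..n+1}" "j \<in> {1..n+1}" "m \<in> {1..n+1}" for i l j m
  proof -
    note c = cl(1)[OF I(1)] cl(1)[OF I(2)] cl(2)[OF I(3)] cl(2)[OF I(4)] closed[OF I(1,3)] closed[OF I(2,4)]
    have "T i \<otimes> U j \<otimes> x i j \<otimes> (T l \<otimes> U m \<otimes> x l m) =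
        T i \<otimes> (U j \<otimes> ((x i j \<otimes> T l) \<otimes> (U m \<otimes> x l m)))"
      using c by (simp only: m_assoc m_closed)
    also have "\<dots> = (torus_weight r l j / torus_weight r l i) \<odot>
        (T i \<otimes> ((U j \<otimes> T l) \<otimes> ((x i j \<otimes> U m) \<otimes> x l m)))"
      unfolding xT[OF I(1,3,2)] using c by (simp add: m_assoc)
    also have "\<dots> = (torus_weight r l j / torus_weight r l i * (torus_weight r m i / torus_weight r m j)) \<odot>
        (T i \<otimes> ((T l \<otimes> U j) \<otimes> ((U m \<otimes> x i j) \<otimes> x l m)))"
      unfolding xU[OF I(1,3,4)] UT[OF I(3,2)] using c by simp
    also have "(T i \<otimes> ((T l \<otimes> U j) \<otimes> ((U m \<otimes> x i j) \<otimes> x l m))) = S i l j m \<otimes> (x i j \<otimes> x l m)"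
      unfolding S_def using c by (simp add: m_assoc)
    finally show ?thesis
      unfolding twist_def D_def using c S_cl[OF I] r sym[of l i] sym[of m i] sym[of m j]
      by (simp add: field_simps)
  qed
  show diag_eq: "twist r T U i i = x i i" if "i \<in> {1..n+1}" for i
    using r TU1[OF that] closed[OF that that] by (simp add: twist_def)
  have tw_cl: "twist r T U i j \<in> carrier A" if "i \<in> {1..n+1}" "j \<in> {1..n+1}" for i j
    unfolding twist_def using cl(1)[OF that(1)] cl(2)[OF that(2)] closed[OF that] by simp
  show "quantum_borel A n q Z (twist r T U)"
  proof (unfold_locales, goal_cases)
    case (1 i j)
    then show ?case by (rule tw_cl)
  next
    case (2 i j m)
    then show ?case
      using S_cl[of i i j m]
      by (simp only: prod row D_sym[of _ _ m j] S_sym[of _ _ m j])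
        (simp add: mult.commute del: atLeastAtMost_iff One_nat_def)
  next
    case (3 i j l)
    then show ?case
      using S_cl[of i l j j]
      by (simp only: prod col D_sym(1)[of l i] S_sym(1)[of l i])
        (simp add: mult.commute del: atLeastAtMost_iff One_nat_def)
  next
    case (4 i j l m)
    then show ?case
      by (simp only: prod D_sym(1)[of l i] D_sym(2)[of _ _ m j] S_sym(1)[of l i] S_sym(2)[of _ _ m j]
          anti[OF 4])
  next
    case (5 i j l m)
    then show ?case
      using S_cl[of i l j m]
      by (simp only: prod D_sym(1)[of l i] D_sym(2)[of _ _ m j] S_sym(1)[of l i] S_sym(2)[of _ _ m j]
          cross[OF 5])
        (simp add: r_distr smult_r_distr mult.commute del: atLeastAtMost_iff One_nat_def)
  next
    case (6 i j)
    then show ?case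
      unfolding twist_def vanish[OF 6] using cl(1)[OF 6(1)] cl(2)[OF 6(2)] by simp
  next
    case 7
    have "foldr (\<lambda>i y. twist r T U i i \<otimes> y) [1..<n+2] \<one> = foldr (\<lambda>i y. x i i \<otimes> y) [1..<n+2] \<one>"
      by (intro foldr_cong) (auto simp: diag_eq simp del: One_nat_def)
    then show ?case using diag by simp
  qed
qed

end

section \<open>The isomorphisms\<close>

lemma Bplus_eq:
  "Oq_Bplus n q = Oq_borel (\<lambda>i j. j < i) n q" "X_Bplus n q = X_borel (\<lambda>i j. j < i) n q"
  by (simp_all add: Oq_Bplus_def Oq_borel_def Bplus_ideal_def borel_ideal_def X_Bplus_def
      X_borel_def fun_eq_iff)

lemma Bminus_eq:
  "Oq_Bminus n q = Oq_borel (\<lambda>i j. i < j) n q" "X_Bminus n q = X_borel (\<lambda>i j. i < j) n q"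
  by (simp_all add: Oq_Bminus_def Oq_borel_def Bminus_ideal_def borel_ideal_def X_Bminus_def
      X_borel_def fun_eq_iff)

lemma quantum_borel_Bplus: "quantum_borel (Oq_Bplus n q) n q (\<lambda>i j. j < i) (X_Bplus n q)"
  unfolding Bplus_eq by (rule quantum_borel_Oq_borel) simp

lemma quantum_borel_Bminus: "quantum_borel (Oq_Bminus n q) n q (\<lambda>i j. i < j) (X_Bminus n q)"
  unfolding Bminus_eq by (rule quantum_borel_Oq_borel) simp

text \<open>The twist by \<open>t\<close>, \<open>u\<close> and the opposite twist by
  \<open>u\<close>, \<open>t\<close> give endomorphisms of the Borel algebra that undo each other on
  the two generating sets.\<close>

lemma Nplus_isomorphic_Nplus':
  assumes q: "q \<noteq> 0"
  shows "algebra_isomorphic (Oq_Nplus n q) (Oq_Nplus' n q)"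
    and "algebra_isomorphic (Oq_Nplus' n q) (Oq_Nplus n q)"
proof -
  let ?B = "Oq_Bplus n q" and ?x = "X_Bplus n q"
  interpret quantum_borel ?B n q "\<lambda>i j. j < i" ?x by (rule quantum_borel_Bplus)
  define t where "t k = ?x k k" for k
  define u where "u k = inv\<^bsub>?B\<^esub> (?x k k)" for k
  have unit: "t k \<in> Units ?B" if "k \<in> {1..n+1}" for k
    using that by (simp add: t_def diag_Units del: One_nat_def)
  have t: "t k \<in> carrier ?B" and u: "u k \<in> carrier ?B"
    and tu: "t k \<otimes>\<^bsub>?B\<^esub> u k = \<one>\<^bsub>?B\<^esub>" and ut: "u k \<otimes>\<^bsub>?B\<^esub> t k = \<one>\<^bsub>?B\<^esub>"
    if "k \<in> {1..n+1}" for k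
    using unit[OF that] by (auto simp: t_def u_def)
  have xt: "?x a b \<otimes>\<^bsub>?B\<^esub> t k = (torus_weight q k b / torus_weight q k a) \<odot>\<^bsub>?B\<^esub> (t k \<otimes>\<^bsub>?B\<^esub> ?x a b)"
    and xu: "?x a b \<otimes>\<^bsub>?B\<^esub> u k = (torus_weight q k a / torus_weight q k b) \<odot>\<^bsub>?B\<^esub> (u k \<otimes>\<^bsub>?B\<^esub> ?x a b)"
    if "a \<in> {1..n+1}" "b \<in> {1..n+1}" "k \<in> {1..n+1}" for a b k
    using torus_action[OF refl q that] torus_action_inv[OF refl q that] by (simp_all add: t_def u_def)
  have tt: "t k \<otimes>\<^bsub>?B\<^esub> t l = t l \<otimes>\<^bsub>?B\<^esub> t k" if "k \<in> {1..n+1}" "l \<in> {1..n+1}" for k l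
    using diag_commute[OF _ that] by (simp add: t_def)
  have comm_u: "y \<otimes>\<^bsub>?B\<^esub> u l = u l \<otimes>\<^bsub>?B\<^esub> y"
    if "y \<in> carrier ?B" "l \<in> {1..n+1}" "y \<otimes>\<^bsub>?B\<^esub> t l = t l \<otimes>\<^bsub>?B\<^esub> y" for y l
    using q_commute_inv[OF that(1) unit[OF that(2)], of 1] that u[OF that(2)] t[OF that(2)]
    by (simp add: t_def u_def)
  have t_u: "t k \<otimes>\<^bsub>?B\<^esub> u l = u l \<otimes>\<^bsub>?B\<^esub> t k" if "k \<in> {1..n+1}" "l \<in> {1..n+1}" for k l
    using comm_u[OF t[OF that(1)] that(2) tt[OF that]] .
  have uu: "u k \<otimes>\<^bsub>?B\<^esub> u l = u l \<otimes>\<^bsub>?B\<^esub> u k" if "k \<in> {1..n+1}" "l \<in> {1..n+1}" for k l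
    using comm_u[OF u[OF that(1)] that(2) t_u[OF that(2,1), symmetric]] .
  have tw1: "quantum_borel ?B n q (\<lambda>i j. j < i) (twist q t u)"
    "\<And>i. i \<in> {1..n+1} \<Longrightarrow> twist q t u i i = ?x i i"
    by (rule quantum_borel_twist[OF q t u tu tt uu t_u[symmetric] xt xu]; assumption)+
  \<comment> \<open>Exchanging \<open>t\<close> and \<open>u\<close> inverts all weights, so the
    parameter becomes \<open>inverse q\<close>.\<close>
  have tw2: "quantum_borel ?B n q (\<lambda>i j. j < i) (twist (inverse q) u t)"
    "\<And>i. i \<in> {1..n+1} \<Longrightarrow> twist (inverse q) u t i i = ?x i i"
    by (rule quantum_borel_twist[OF _ u t ut uu tt t_u]; simp add: q xt xu divide_inverse mult.commute del: One_nat_def atLeastAtMost_iff)+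
  obtain f where f: "f \<in> algebra_hom ?B ?B"
    and fx: "\<And>i j. i \<in> {1..n+1} \<Longrightarrow> j \<in> {1..n+1} \<Longrightarrow> f (?x i j) = twist q t u i j"
    using Oq_borel_lift[OF _ tw1(1)] unfolding Bplus_eq by blast
  obtain g where g: "g \<in> algebra_hom ?B ?B"
    and gx: "\<And>i j. i \<in> {1..n+1} \<Longrightarrow> j \<in> {1..n+1} \<Longrightarrow> g (?x i j) = twist (inverse q) u t i j"
    using Oq_borel_lift[OF _ tw2(1)] unfolding Bplus_eq by blast
  note alg = unital_algebra_axioms
  \<comment> \<open>Both twists fix the diagonal entries, hence also their inverses.\<close>
  have fu: "f (u i) = u i" and gu: "g (u i) = u i" if "i \<in> {1..n+1}" for i
    using algebra_hom_inv[OF alg alg f unit[OF that]] algebra_hom_inv[OF alg alg g unit[OF that]]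
      fx[OF that that] gx[OF that that] tw1(2)[OF that] tw2(2)[OF that]
    by (simp_all add: t_def u_def)
  \<comment> \<open>In the image of \<open>u i \<otimes> x i j\<close> the factors
    \<open>u i\<close> and \<open>t i\<close> cancel, leaving \<open>inverse q\<close> times
    \<open>u j \<otimes> x i j\<close>. This scalar is the one that moves \<open>u j\<close> to the
    right of \<open>x i j\<close>.\<close>
  have key: "f (u i \<otimes>\<^bsub>?B\<^esub> ?x i j) = ?x i j \<otimes>\<^bsub>?B\<^esub> u j"
    "g (?x i j \<otimes>\<^bsub>?B\<^esub> u j) = u i \<otimes>\<^bsub>?B\<^esub> ?x i j"
    if I: "i \<in> {1..n+1}" "j \<in> {1..n+1}" "i < j" for i j
  proof -
    note c = t[OF I(1)] t[OF I(2)] u[OF I(1)] u[OF I(2)] closed[OF I(1,2)]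
    have xu': "?x i j \<otimes>\<^bsub>?B\<^esub> u j = inverse q \<odot>\<^bsub>?B\<^esub> (u j \<otimes>\<^bsub>?B\<^esub> ?x i j)"
      using xu[OF I(1,2,2)] I(3) by (simp add: torus_weight_def inverse_eq_divide)
    have "f (u i \<otimes>\<^bsub>?B\<^esub> ?x i j) = u i \<otimes>\<^bsub>?B\<^esub> twist q t u i j"
      using c by (simp only: algebra_hom_mult[OF f] fu[OF I(1)] fx[OF I(1,2)])
    also have "\<dots> = inverse q \<odot>\<^bsub>?B\<^esub> ((u i \<otimes>\<^bsub>?B\<^esub> t i) \<otimes>\<^bsub>?B\<^esub> (u j \<otimes>\<^bsub>?B\<^esub> ?x i j))"
      using c I(3) by (simp add: twist_def torus_weight_def m_assoc inverse_eq_divide)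
    also have "\<dots> = ?x i j \<otimes>\<^bsub>?B\<^esub> u j"
      using c by (simp add: ut[OF I(1)] xu' del: One_nat_def)
    finally show "f (u i \<otimes>\<^bsub>?B\<^esub> ?x i j) = ?x i j \<otimes>\<^bsub>?B\<^esub> u j" .
    have "g (?x i j \<otimes>\<^bsub>?B\<^esub> u j) = twist (inverse q) u t i j \<otimes>\<^bsub>?B\<^esub> u j"
      using c by (simp only: algebra_hom_mult[OF g] gu[OF I(2)] gx[OF I(1,2)])
    also have "\<dots> = q \<odot>\<^bsub>?B\<^esub> (u i \<otimes>\<^bsub>?B\<^esub> (t j \<otimes>\<^bsub>?B\<^esub> (?x i j \<otimes>\<^bsub>?B\<^esub> u j)))"
      using c I(3) by (simp add: twist_def torus_weight_def m_assoc inverse_eq_divide)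
    also have "\<dots> = u i \<otimes>\<^bsub>?B\<^esub> ((t j \<otimes>\<^bsub>?B\<^esub> u j) \<otimes>\<^bsub>?B\<^esub> ?x i j)"
      unfolding xu' using c q by (simp add: m_assoc)
    also have "\<dots> = u i \<otimes>\<^bsub>?B\<^esub> ?x i j"
      using c by (simp add: tu[OF I(2)])
    finally show "g (?x i j \<otimes>\<^bsub>?B\<^esub> u j) = u i \<otimes>\<^bsub>?B\<^esub> ?x i j" .
  qed
  let ?G = "{u i \<otimes>\<^bsub>?B\<^esub> ?x i j | i j. 1 \<le> i \<and> i < j \<and> j \<le> n+1}"
  let ?H = "{?x i j \<otimes>\<^bsub>?B\<^esub> u j | i j. 1 \<le> i \<and> i < j \<and> j \<le> n+1}"
  have I: "i \<in> {1..n+1} \<and> j \<in> {1..n+1}" if "1 \<le> i \<and> i < j \<and> j \<le> n+1" for i j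
    using that by auto
  have G: "?G \<subseteq> carrier ?B" and H: "?H \<subseteq> carrier ?B"
    using I u closed m_closed by blast+
  have fG: "f y \<in> carrier (generated_subalgebra ?B ?H) \<and> g (f y) = y" if y: "y \<in> ?G" for y
  proof -
    obtain i j where ij: "1 \<le> i \<and> i < j \<and> j \<le> n+1" "y = u i \<otimes>\<^bsub>?B\<^esub> ?x i j" using y by blast
    then have "f y = ?x i j \<otimes>\<^bsub>?B\<^esub> u j" "g (f y) = y" using key[of i j] I[OF ij(1)] by simp_all
    then show ?thesis using ij(1) generated_subalgebra_incl[of ?H ?B] by blast
  qed
  have gH: "g y \<in> carrier (generated_subalgebra ?B ?G) \<and> f (g y) = y" if y: "y \<in> ?H" for y
  proof -
    obtain i j where ij: "1 \<le> i \<and> i < j \<and> j \<le> n+1" "y = ?x i j \<otimes>\<^bsub>?B\<^esub> u j" using y by blast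
    then have "g y = u i \<otimes>\<^bsub>?B\<^esub> ?x i j" "f (g y) = y" using key[of i j] I[OF ij(1)] by simp_all
    then show ?thesis using ij(1) generated_subalgebra_incl[of ?G ?B] by blast
  qed
  show "algebra_isomorphic (Oq_Nplus n q) (Oq_Nplus' n q)"
    using algebra_isomorphic_generated[OF alg alg f g G H fG gH]
    by (simp only: Oq_Nplus_def Oq_Nplus'_def u_def)
  show "algebra_isomorphic (Oq_Nplus' n q) (Oq_Nplus n q)"
    using algebra_isomorphic_generated[OF alg alg g f H G gH fG]
    by (simp only: Oq_Nplus_def Oq_Nplus'_def u_def)
qed

text \<open>
  Transposition exchanges \<open>O\<^sub>q(B\<^sup>+)\<close> and \<open>O\<^sub>q(B\<^sup>-)\<close>; it matches the given generators of the
  subalgebras only up to the scalar \<open>q\<close>.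
\<close>

lemma Nplus_isomorphic_Nminus:
  assumes q: "q \<noteq> 0"
  shows "algebra_isomorphic (Oq_Nplus n q) (Oq_Nminus' n q)"
    and "algebra_isomorphic (Oq_Nminus' n q) (Oq_Nplus n q)"
    and "algebra_isomorphic (Oq_Nplus' n q) (Oq_Nminus n q)"
    and "algebra_isomorphic (Oq_Nminus n q) (Oq_Nplus' n q)"
proof -
  let ?P = "Oq_Bplus n q" and ?x = "X_Bplus n q" and ?M = "Oq_Bminus n q" and ?y = "X_Bminus n q"
  interpret P: quantum_borel ?P n q "\<lambda>i j. j < i" ?x by (rule quantum_borel_Bplus)
  interpret M: quantum_borel ?M n q "\<lambda>i j. i < j" ?y by (rule quantum_borel_Bminus)
  note algP = P.unital_algebra_axioms and algM = M.unital_algebra_axioms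
  obtain f where f: "f \<in> algebra_hom ?P ?M"
    and fx: "\<And>i j. i \<in> {1..n+1} \<Longrightarrow> j \<in> {1..n+1} \<Longrightarrow> f (?x i j) = ?y j i"
    using Oq_borel_lift[OF _ M.transpose] unfolding Bplus_eq by blast
  obtain g where g: "g \<in> algebra_hom ?M ?P"
    and gy: "\<And>i j. i \<in> {1..n+1} \<Longrightarrow> j \<in> {1..n+1} \<Longrightarrow> g (?y i j) = ?x j i"
    using Oq_borel_lift[OF _ P.transpose] unfolding Bminus_eq by blast
  have uP: "?x i i \<in> Units ?P" and uM: "?y i i \<in> Units ?M" if "i \<in> {1..n+1}" for i
    using P.diag_Units[OF _ that] M.diag_Units[OF _ that] by simp_all
  have cP: "?x i i \<in> carrier ?P" "inv\<^bsub>?P\<^esub> (?x i i) \<in> carrier ?P"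
    and cM: "?y i i \<in> carrier ?M" "inv\<^bsub>?M\<^esub> (?y i i) \<in> carrier ?M" if "i \<in> {1..n+1}" for i
    using uP[OF that] uM[OF that] by auto
  have fu: "f (inv\<^bsub>?P\<^esub> (?x i i)) = inv\<^bsub>?M\<^esub> (?y i i)" and gu: "g (inv\<^bsub>?M\<^esub> (?y i i)) = inv\<^bsub>?P\<^esub> (?x i i)"
    if "i \<in> {1..n+1}" for i
    using algebra_hom_inv[OF algP algM f uP[OF that]] algebra_hom_inv[OF algM algP g uM[OF that]]
      fx[OF that that] gy[OF that that] by simp_all
  have I: "i \<in> {1..n+1} \<and> j \<in> {1..n+1}" if "1 \<le> i \<and> i < j \<and> j \<le> n+1" for i j
    using that by auto
  have xi: "?x i j \<otimes>\<^bsub>?P\<^esub> inv\<^bsub>?P\<^esub> (?x i i) = q \<odot>\<^bsub>?P\<^esub> (inv\<^bsub>?P\<^esub> (?x i i) \<otimes>\<^bsub>?P\<^esub> ?x i j)"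
    and xj: "?x i j \<otimes>\<^bsub>?P\<^esub> inv\<^bsub>?P\<^esub> (?x j j) = inverse q \<odot>\<^bsub>?P\<^esub> (inv\<^bsub>?P\<^esub> (?x j j) \<otimes>\<^bsub>?P\<^esub> ?x i j)"
    and yi: "?y j i \<otimes>\<^bsub>?M\<^esub> inv\<^bsub>?M\<^esub> (?y i i) = q \<odot>\<^bsub>?M\<^esub> (inv\<^bsub>?M\<^esub> (?y i i) \<otimes>\<^bsub>?M\<^esub> ?y j i)"
    and yj: "?y j i \<otimes>\<^bsub>?M\<^esub> inv\<^bsub>?M\<^esub> (?y j j) = inverse q \<odot>\<^bsub>?M\<^esub> (inv\<^bsub>?M\<^esub> (?y j j) \<otimes>\<^bsub>?M\<^esub> ?y j i)"
    if ij: "1 \<le> i \<and> i < j \<and> j \<le> n+1" for i j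
  proof -
    \<comment> \<open>The transposed entries of the lower Borel algebra form an upper triangular
      system, so the torus action computed for that shape covers both algebras.\<close>
    interpret T: quantum_borel ?M n q "\<lambda>i j. j < i" "\<lambda>i j. ?y j i" by (rule M.transpose)
    have i: "i \<in> {1..n+1}" and j: "j \<in> {1..n+1}" using I[OF ij] by auto
    note * = P.torus_action_inv[OF refl q i j] T.torus_action_inv[OF refl q i j]
    show "?x i j \<otimes>\<^bsub>?P\<^esub> inv\<^bsub>?P\<^esub> (?x i i) = q \<odot>\<^bsub>?P\<^esub> (inv\<^bsub>?P\<^esub> (?x i i) \<otimes>\<^bsub>?P\<^esub> ?x i j)"
      "?x i j \<otimes>\<^bsub>?P\<^esub> inv\<^bsub>?P\<^esub> (?x j j) = inverse q \<odot>\<^bsub>?P\<^esub> (inv\<^bsub>?P\<^esub> (?x j j) \<otimes>\<^bsub>?P\<^esub> ?x i j)"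
      "?y j i \<otimes>\<^bsub>?M\<^esub> inv\<^bsub>?M\<^esub> (?y i i) = q \<odot>\<^bsub>?M\<^esub> (inv\<^bsub>?M\<^esub> (?y i i) \<otimes>\<^bsub>?M\<^esub> ?y j i)"
      "?y j i \<otimes>\<^bsub>?M\<^esub> inv\<^bsub>?M\<^esub> (?y j j) = inverse q \<odot>\<^bsub>?M\<^esub> (inv\<^bsub>?M\<^esub> (?y j j) \<otimes>\<^bsub>?M\<^esub> ?y j i)"
      using *[OF i] *[OF j] ij by (simp_all add: torus_weight_def inverse_eq_divide)
  qed
  let ?G = "{inv\<^bsub>?P\<^esub> ?x i i \<otimes>\<^bsub>?P\<^esub> ?x i j | i j. 1 \<le> i \<and> i < j \<and> j \<le> n+1}"
  let ?G' = "{?x i j \<otimes>\<^bsub>?P\<^esub> inv\<^bsub>?P\<^esub> ?x j j | i j. 1 \<le> i \<and> i < j \<and> j \<le> n+1}"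
  let ?H = "{inv\<^bsub>?M\<^esub> ?y j j \<otimes>\<^bsub>?M\<^esub> ?y j i | i j. 1 \<le> i \<and> i < j \<and> j \<le> n+1}"
  let ?H' = "{?y j i \<otimes>\<^bsub>?M\<^esub> inv\<^bsub>?M\<^esub> ?y i i | i j. 1 \<le> i \<and> i < j \<and> j \<le> n+1}"
  have cl: "?G \<subseteq> carrier ?P" "?G' \<subseteq> carrier ?P" "?H \<subseteq> carrier ?M" "?H' \<subseteq> carrier ?M"
    using I cP cM P.closed M.closed P.m_closed M.m_closed by blast+
  have fG: "f z \<in> carrier (generated_subalgebra ?M ?H') \<and> g (f z) = z" if z: "z \<in> ?G" for z
  proof -
    obtain i j where ij: "1 \<le> i \<and> i < j \<and> j \<le> n+1" "z = inv\<^bsub>?P\<^esub> ?x i i \<otimes>\<^bsub>?P\<^esub> ?x i j"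
      using z by blast
    have i: "i \<in> {1..n+1}" and j: "j \<in> {1..n+1}" using I[OF ij(1)] by auto
    have fz: "f z = inv\<^bsub>?M\<^esub> ?y i i \<otimes>\<^bsub>?M\<^esub> ?y j i"
      using cP[OF i] P.closed[OF i j] by (simp only: ij(2) algebra_hom_mult[OF f] fu[OF i] fx[OF i j])
    \<comment> \<open>The image has its torus factor on the left, while the generators in
      \<open>?H'\<close> have it on the right; exchanging the two factors costs this scalar. The
      three parallel arguments below treat their generators in the same way.\<close>
    also have "\<dots> = inverse q \<odot>\<^bsub>?M\<^esub> (?y j i \<otimes>\<^bsub>?M\<^esub> inv\<^bsub>?M\<^esub> ?y i i)"
      using yi[OF ij(1)] cM[OF i] M.closed[OF j i] q by simp
    also have "\<dots> \<in> carrier (generated_subalgebra ?M ?H')"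
      using ij(1) by (intro smult_in_generated_subalgebra) blast
    finally show ?thesis
      using fz cM[OF i] M.closed[OF j i]
      by (simp only: ij(2) algebra_hom_mult[OF g] gu[OF i] gy[OF j i])
  qed
  have gH': "g z \<in> carrier (generated_subalgebra ?P ?G) \<and> f (g z) = z" if z: "z \<in> ?H'" for z
  proof -
    obtain i j where ij: "1 \<le> i \<and> i < j \<and> j \<le> n+1" "z = ?y j i \<otimes>\<^bsub>?M\<^esub> inv\<^bsub>?M\<^esub> ?y i i"
      using z by blast
    have i: "i \<in> {1..n+1}" and j: "j \<in> {1..n+1}" using I[OF ij(1)] by auto
    have gz: "g z = ?x i j \<otimes>\<^bsub>?P\<^esub> inv\<^bsub>?P\<^esub> ?x i i"
      using cM[OF i] M.closed[OF j i] by (simp only: ij(2) algebra_hom_mult[OF g] gu[OF i] gy[OF j i])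
    also have "\<dots> = q \<odot>\<^bsub>?P\<^esub> (inv\<^bsub>?P\<^esub> ?x i i \<otimes>\<^bsub>?P\<^esub> ?x i j)"
      by (rule xi[OF ij(1)])
    also have "\<dots> \<in> carrier (generated_subalgebra ?P ?G)"
      using ij(1) by (intro smult_in_generated_subalgebra) blast
    finally show ?thesis
      using gz cP[OF i] P.closed[OF i j]
      by (simp only: ij(2) algebra_hom_mult[OF f] fu[OF i] fx[OF i j])
  qed
  have fG': "f z \<in> carrier (generated_subalgebra ?M ?H) \<and> g (f z) = z" if z: "z \<in> ?G'" for z
  proof -
    obtain i j where ij: "1 \<le> i \<and> i < j \<and> j \<le> n+1" "z = ?x i j \<otimes>\<^bsub>?P\<^esub> inv\<^bsub>?P\<^esub> ?x j j"
      using z by blast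
    have i: "i \<in> {1..n+1}" and j: "j \<in> {1..n+1}" using I[OF ij(1)] by auto
    have fz: "f z = ?y j i \<otimes>\<^bsub>?M\<^esub> inv\<^bsub>?M\<^esub> ?y j j"
      using cP[OF j] P.closed[OF i j] by (simp only: ij(2) algebra_hom_mult[OF f] fu[OF j] fx[OF i j])
    also have "\<dots> = inverse q \<odot>\<^bsub>?M\<^esub> (inv\<^bsub>?M\<^esub> ?y j j \<otimes>\<^bsub>?M\<^esub> ?y j i)"
      by (rule yj[OF ij(1)])
    also have "\<dots> \<in> carrier (generated_subalgebra ?M ?H)"
      using ij(1) by (intro smult_in_generated_subalgebra) blast
    finally show ?thesis
      using fz cM[OF j] M.closed[OF j i]
      by (simp only: ij(2) algebra_hom_mult[OF g] gu[OF j] gy[OF j i])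
  qed
  have gH: "g z \<in> carrier (generated_subalgebra ?P ?G') \<and> f (g z) = z" if z: "z \<in> ?H" for z
  proof -
    obtain i j where ij: "1 \<le> i \<and> i < j \<and> j \<le> n+1" "z = inv\<^bsub>?M\<^esub> ?y j j \<otimes>\<^bsub>?M\<^esub> ?y j i"
      using z by blast
    have i: "i \<in> {1..n+1}" and j: "j \<in> {1..n+1}" using I[OF ij(1)] by auto
    have gz: "g z = inv\<^bsub>?P\<^esub> ?x j j \<otimes>\<^bsub>?P\<^esub> ?x i j"
      using cM[OF j] M.closed[OF j i] by (simp only: ij(2) algebra_hom_mult[OF g] gu[OF j] gy[OF j i])
    also have "\<dots> = q \<odot>\<^bsub>?P\<^esub> (?x i j \<otimes>\<^bsub>?P\<^esub> inv\<^bsub>?P\<^esub> ?x j j)"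
      using xj[OF ij(1)] cP[OF j] P.closed[OF i j] q by simp
    also have "\<dots> \<in> carrier (generated_subalgebra ?P ?G')"
      using ij(1) by (intro smult_in_generated_subalgebra) blast
    finally show ?thesis
      using gz cP[OF j] P.closed[OF i j]
      by (simp only: ij(2) algebra_hom_mult[OF f] fu[OF j] fx[OF i j])
  qed
  show "algebra_isomorphic (Oq_Nplus n q) (Oq_Nminus' n q)"
    unfolding Oq_Nplus_def Oq_Nminus'_def
    by (rule algebra_isomorphic_generated[OF algP algM f g cl(1,4) fG gH'])
  show "algebra_isomorphic (Oq_Nminus' n q) (Oq_Nplus n q)"
    unfolding Oq_Nplus_def Oq_Nminus'_def
    by (rule algebra_isomorphic_generated[OF algM algP g f cl(4,1) gH' fG])
  show "algebra_isomorphic (Oq_Nplus' n q) (Oq_Nminus n q)"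
    unfolding Oq_Nplus'_def Oq_Nminus_def
    by (rule algebra_isomorphic_generated[OF algP algM f g cl(2,3) fG' gH])
  show "algebra_isomorphic (Oq_Nminus n q) (Oq_Nplus' n q)"
    unfolding Oq_Nplus'_def Oq_Nminus_def
    by (rule algebra_isomorphic_generated[OF algM algP g f cl(3,2) gH fG'])
qed

theorem theorem2:
  fixes q :: "'k::field" and n :: nat
  assumes "q \<noteq> 0"
    and "\<forall>m::nat. m > 0 \<longrightarrow> q ^ m \<noteq> 1"
    and "n \<ge> 1"
  shows "\<forall>A \<in> {Oq_Nplus n q, Oq_Nplus' n q, Oq_Nminus n q, Oq_Nminus' n q}.
         \<forall>B \<in> {Oq_Nplus n q, Oq_Nplus' n q, Oq_Nminus n q, Oq_Nminus' n q}.
           algebra_isomorphic A B"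
proof -
  \<comment> \<open>\<open>Oq_Nplus n q\<close> serves as a hub: it is linked to each of the four
    algebras in both directions, and any two of them are then joined by composing through
    it.\<close>
  have "algebra_isomorphic (Oq_Nplus n q) A \<and> algebra_isomorphic A (Oq_Nplus n q)"
    if "A \<in> {Oq_Nplus n q, Oq_Nplus' n q, Oq_Nminus n q, Oq_Nminus' n q}" for A
    using that Nplus_isomorphic_Nplus'[OF assms(1), of n] Nplus_isomorphic_Nminus[OF assms(1), of n]
      algebra_isomorphic_refl algebra_isomorphic_trans by blast
  then show ?thesis using algebra_isomorphic_trans by blast
qed

end
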